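(* Let $\mathcal{L}:\mathbb{R}\to\mathbb{C}^{n\times n}$ be a real analytic Hermitian matrix pencil (i.e. $\mathcal{L}$ is real analytic and $\mathcal{L}(\lambda)$ is Hermitian for each $\lambda\in\mathbb{R}$) all of whose real characteristic values are isolated. Then for any real $\lambda_1<\lambda_2$ $$n\big(\mathcal{L}(\lambda_1)\big)-n\big(\mathcal{L}(\lambda_2)\big)+Z^{\downarrow}_{\lambda_1^+}-Z^{\downarrow}_{\lambda_2^-}=\sum_{\substack{\lambda_1<\lambda<\lambda_2\\ \lambda\in\sigma(\mathcal{L})}}\kappa(\lambda).$$
   Context: A real characteristic value of $\mathcal{L}$ is a $\lambda_0\in\mathbb{R}$ with $\operatorname{Ker}\mathcal{L}(\lambda_0)\ne\{0\}$; $\sigma(\mathcal{L})$ denotes the set of characteristic values of $\mathcal{L}$. For a Hermitian matrix $A$, $n(A)$ is the number of negative eigenvalues counted with multiplicity. By analytic perturbation theory the eigenvalues of $\mathcal{L}(\lambda)$, $\lambda\in\mathbb{R}$, counted with multiplicity, are given by $n$ real analytic functions $\mu_1(\lambda),\dots,\mu_n(\lambda)$ (eigenvalue branches). For $\lambda_0\in\mathbb{R}$, $Z^{\downarrow}_{\lambda_0^-}$ (respectively $Z^{\downarrow}_{\lambda_0^+}$) is the number, counting multiplicity, of eigenvalue branches $\mu$ with $\mu(\lambda_0)=0$ and $\mu(\lambda)<0$ for $\lambda\in(\lambda_0-\varepsilon,\lambda_0)$ (respectively for $\lambda\in(\lambda_0,\lambda_0+\varepsilon)$) for all sufficiently small $\varepsilon>0$;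 it is $0$ if $\lambda_0$ is not a characteristic value. Krein signature: let $\lambda_0$ be an isolated real characteristic value and $\mu$ an eigenvalue branch with $\mu^{(j)}(\lambda_0)=0$ for $j=0,\dots,m-1$ and $\mu^{(m)}(\lambda_0)\neq0$, $m\ge1$; let $\eta(\mu)=\operatorname{sign}\mu^{(m)}(\lambda_0)$. Put $\kappa^{\pm}(\mu,\lambda_0)=\tfrac12 m$ if $m$ is even and $\kappa^{\pm}(\mu,\lambda_0)=\tfrac12(m\pm\eta(\mu))$ if $m$ is odd. Then $\kappa^\pm(\lambda_0)$ is the sum of $\kappa^\pm(\mu,\lambda_0)$ over all eigenvalue branches vanishing at $\lambda_0$, and $\kappa(\lambda_0)=\kappa^+(\lambda_0)-\kappa^-(\lambda_0)$ is the (graphical) Krein signature of $\lambda_0$. *)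

theory Defs
  imports
    "HOL-Analysis.Derivative"
    "HOL-Analysis.Isolated"
    "Jordan_Normal_Form.Char_Poly"
    "Jordan_Normal_Form.Matrix_Kernel"
    "Jordan_Normal_Form.Schur_Decomposition"
begin

text \<open>Real analyticity on the whole real line: at every point the function agrees, in a
  neighbourhood, with a convergent power series.  (The library's \<open>analytic_on\<close> is about
  functions of a complex variable.)\<close>

definition real_analytic :: "(real \<Rightarrow> 'a::real_normed_vector) \<Rightarrow> bool" where
  "real_analytic f \<longleftrightarrow>
     (\<forall>t0. \<exists>(a :: nat \<Rightarrow> 'a) r. r > 0 \<and>
        (\<forall>t. \<bar>t - t0\<bar> < r \<longrightarrow> (\<lambda>k. (t - t0) ^ k *\<^sub>R a k) sums f t))"

definition hermitian_mat :: "complex mat \<Rightarrow> bool" where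
  "hermitian_mat A \<longleftrightarrow> mat_adjoint A = A"

definition analytic_hermitian_pencil :: "nat \<Rightarrow> (real \<Rightarrow> complex mat) \<Rightarrow> bool" where
  "analytic_hermitian_pencil n L \<longleftrightarrow>
     (\<forall>t. L t \<in> carrier_mat n n \<and> hermitian_mat (L t)) \<and>
     (\<forall>i<n. \<forall>j<n. real_analytic (\<lambda>t. L t $$ (i, j)))"

definition char_values :: "nat \<Rightarrow> (real \<Rightarrow> complex mat) \<Rightarrow> real set" where
  "char_values n L = {t. mat_kernel (L t) \<noteq> {0\<^sub>v n}}"

definition eig_mult :: "complex mat \<Rightarrow> complex \<Rightarrow> nat" where
  "eig_mult A z = Polynomial.order z (char_poly A)"

definition neg_index :: "complex mat \<Rightarrow> nat" where
  "neg_index A =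
     (\<Sum>x\<in>{x::real. x < 0 \<and> eigenvalue A (complex_of_real x)}. eig_mult A (complex_of_real x))"

definition is_eigenvalue_branches ::
    "nat \<Rightarrow> (real \<Rightarrow> complex mat) \<Rightarrow> (nat \<Rightarrow> real \<Rightarrow> real) \<Rightarrow> bool" where
  "is_eigenvalue_branches n L \<mu> \<longleftrightarrow>
     (\<forall>i<n. real_analytic (\<mu> i)) \<and>
     (\<forall>t z. eig_mult (L t) z = card {i. i < n \<and> complex_of_real (\<mu> i t) = z})"

text \<open>For an analytic Hermitian pencil such a family exists by analytic perturbation theory
  (Rellich), and by the identity theorem it is unique up to a permutation of the indices below
  \<open>n\<close>.  The quantities below are symmetric in these indices, so they do not depend on
  the choice made here.\<close>

definition eigenvalue_branches ::
    "nat \<Rightarrow> (real \<Rightarrow> complex mat) \<Rightarrow> nat \<Rightarrow> real \<Rightarrow> real" where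
  "eigenvalue_branches n L = (SOME \<mu>. is_eigenvalue_branches n L \<mu>)"

definition vanishing_branches :: "nat \<Rightarrow> (real \<Rightarrow> complex mat) \<Rightarrow> real \<Rightarrow> nat set" where
  "vanishing_branches n L t0 = {i. i < n \<and> eigenvalue_branches n L i t0 = 0}"

definition Z_down_left :: "nat \<Rightarrow> (real \<Rightarrow> complex mat) \<Rightarrow> real \<Rightarrow> nat" where
  "Z_down_left n L t0 =
     card {i \<in> vanishing_branches n L t0.
             eventually (\<lambda>t. eigenvalue_branches n L i t < 0) (at_left t0)}"

definition Z_down_right :: "nat \<Rightarrow> (real \<Rightarrow> complex mat) \<Rightarrow> real \<Rightarrow> nat" where
  "Z_down_right n L t0 =
     card {i \<in> vanishing_branches n L t0.
             eventually (\<lambda>t. eigenvalue_branches n L i t < 0) (at_right t0)}"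

text \<open>The order of vanishing is meaningful only for branches that do not vanish identically;
  when all characteristic values are isolated, no branch does.\<close>

definition vanishing_order :: "(real \<Rightarrow> real) \<Rightarrow> real \<Rightarrow> nat" where
  "vanishing_order f t0 = (LEAST m. (deriv ^^ m) f t0 \<noteq> 0)"

definition branch_sign :: "(real \<Rightarrow> real) \<Rightarrow> real \<Rightarrow> real" where
  "branch_sign f t0 = sgn ((deriv ^^ vanishing_order f t0) f t0)"

definition krein_branch_plus :: "(real \<Rightarrow> real) \<Rightarrow> real \<Rightarrow> real" where
  "krein_branch_plus f t0 =
     (let m = vanishing_order f t0
      in if even m then real m / 2 else (real m + branch_sign f t0) / 2)"

definition krein_branch_minus :: "(real \<Rightarrow> real) \<Rightarrow> real \<Rightarrow> real" where
  "krein_branch_minus f t0 =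
     (let m = vanishing_order f t0
      in if even m then real m / 2 else (real m - branch_sign f t0) / 2)"

definition krein_plus :: "nat \<Rightarrow> (real \<Rightarrow> complex mat) \<Rightarrow> real \<Rightarrow> real" where
  "krein_plus n L t0 =
     (\<Sum>i\<in>vanishing_branches n L t0. krein_branch_plus (eigenvalue_branches n L i) t0)"

definition krein_minus :: "nat \<Rightarrow> (real \<Rightarrow> complex mat) \<Rightarrow> real \<Rightarrow> real" where
  "krein_minus n L t0 =
     (\<Sum>i\<in>vanishing_branches n L t0. krein_branch_minus (eigenvalue_branches n L i) t0)"

definition krein_signature :: "nat \<Rightarrow> (real \<Rightarrow> complex mat) \<Rightarrow> real \<Rightarrow> real" where
  "krein_signature n L t0 = krein_plus n L t0 - krein_minus n L t0"

end

theory Submission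
  imports Defs "HOL-Complex_Analysis.Complex_Analysis"
begin

text \<open>The characteristic polynomial of the pencil extends near each real point to a family of monic
  polynomials with holomorphic coefficients, all of whose roots are real at real parameters. Such
  a family splits into linear factors with holomorphic roots (Rellich's theorem): if the roots at
  the base point are not all equal, the family factors holomorphically into two families of smaller
  degree; if they are, subtracting their mean and dividing them by a power of the parameter leads
  to a family with distinct roots at the base point. The local branches are glued along the real
  line by means of the identity theorem.

  For a single branch the two indicators ``negative just before \<open>t\<close>'' and ``negative just after
  \<open>t\<close>'' differ exactly by the contribution of the branch to the Krein signature at \<open>t\<close>, and between
  consecutive zeros they agree. The theorem is the telescoping sum of these jumps over the zeros in
  \<open>(l1, l2)\<close>, added up over all branches.\<close>

section \<open>Holomorphic factorization of polynomial families\<close>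

text \<open>\<open>eigenvalue_branches\<close> is a choice by \<open>SOME\<close>, so it carries
  information only after some family of branches has been shown to exist; this existence, not the
  counting, fills most of the development. The obstacle is that roots of a holomorphic family need
  not be holomorphic: x^2 - z has no holomorphic root near 0. Reality of the roots at real
  parameters is what excludes such fractional exponents: a sum of squares of real roots has the same
  sign on both sides of 0, hence even order there, and it bounds every single root. Only the
  characteristic polynomial is continued to complex parameters; no family of eigenvectors is
  followed. Isolation of the characteristic values serves two ends: no branch vanishes on an
  interval, so orders of vanishing are meaningful, and only finitely many zeros lie between the two
  endpoints.\<close>

definition holo_poly :: "(complex \<Rightarrow> complex poly) \<Rightarrow> complex set \<Rightarrow> bool" where
  "holo_poly P S \<longleftrightarrow> (\<forall>k. (\<lambda>z. coeff (P z) k) holomorphic_on S)"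

lemma holo_polyD: "holo_poly P S \<Longrightarrow> (\<lambda>z. coeff (P z) k) holomorphic_on S"
  by (simp add: holo_poly_def)

lemma holo_poly_subset: "holo_poly P S \<Longrightarrow> T \<subseteq> S \<Longrightarrow> holo_poly P T"
  by (auto simp: holo_poly_def intro: holomorphic_on_subset)

lemma holo_poly_const: "holo_poly (\<lambda>z. p) S"
  by (simp add: holo_poly_def)

lemma holo_poly_add: "holo_poly P S \<Longrightarrow> holo_poly Q S \<Longrightarrow> holo_poly (\<lambda>z. P z + Q z) S"
  by (auto simp: holo_poly_def intro!: holomorphic_intros)

lemma holo_poly_diff: "holo_poly P S \<Longrightarrow> holo_poly Q S \<Longrightarrow> holo_poly (\<lambda>z. P z - Q z) S"
  by (auto simp: holo_poly_def intro!: holomorphic_intros)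

lemma holo_poly_mult: "holo_poly P S \<Longrightarrow> holo_poly Q S \<Longrightarrow> holo_poly (\<lambda>z. P z * Q z) S"
  by (auto simp: holo_poly_def coeff_mult intro!: holomorphic_intros)

lemma holo_poly_pCons:
  "f holomorphic_on S \<Longrightarrow> holo_poly P S \<Longrightarrow> holo_poly (\<lambda>z. pCons (f z) (P z)) S"
  unfolding holo_poly_def
proof
  fix k assume "f holomorphic_on S" "\<forall>k. (\<lambda>z. coeff (P z) k) holomorphic_on S"
  then show "(\<lambda>z. coeff (pCons (f z) (P z)) k) holomorphic_on S"
    by (cases k) auto
qed

lemma holo_poly_smult:
  "f holomorphic_on S \<Longrightarrow> holo_poly P S \<Longrightarrow> holo_poly (\<lambda>z. Polynomial.smult (f z) (P z)) S"
  by (auto simp: holo_poly_def intro!: holomorphic_intros)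

lemma holo_poly_sum:
  "(\<And>i. i \<in> I \<Longrightarrow> holo_poly (P i) S) \<Longrightarrow> holo_poly (\<lambda>z. \<Sum>i\<in>I. P i z) S"
  by (auto simp: holo_poly_def coeff_sum intro!: holomorphic_intros)

lemma holo_poly_prod:
  "(\<And>i. i \<in> I \<Longrightarrow> holo_poly (P i) S) \<Longrightarrow> holo_poly (\<lambda>z. \<Prod>i\<in>I. P i z) S"
  by (induction I rule: infinite_finite_induct) (auto intro: holo_poly_const holo_poly_mult)

lemma holo_poly_power: "holo_poly P S \<Longrightarrow> holo_poly (\<lambda>z. P z ^ n) S"
  by (induction n) (auto intro: holo_poly_const holo_poly_mult)

section \<open>The l1 norm of the coefficients of a polynomial\<close>

definition pnorm :: "complex poly \<Rightarrow> real" where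
  "pnorm p = (\<Sum>i\<le>degree p. norm (coeff p i))"

lemma pnorm_eq_sum: "degree p \<le> N \<Longrightarrow> pnorm p = (\<Sum>i\<le>N. norm (coeff p i))"
  unfolding pnorm_def by (rule sum.mono_neutral_left) (auto simp: coeff_eq_0)

lemma pnorm_nonneg [simp]: "0 \<le> pnorm p"
  by (simp add: pnorm_def sum_nonneg)

lemma pnorm_0 [simp]: "pnorm 0 = 0"
  by (simp add: pnorm_def)

lemma norm_coeff_le_pnorm: "norm (coeff p i) \<le> pnorm p"
proof (cases "i \<le> degree p")
  case True
  then show ?thesis unfolding pnorm_def
    by (intro member_le_sum) auto
qed (simp add: coeff_eq_0)

lemma pnorm_triangle: "pnorm (p + q) \<le> pnorm p + pnorm q"
proof -
  define N where "N = max (degree p) (degree q)"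
  have "degree (p + q) \<le> N"
    using degree_add_le_max N_def by metis
  then have "pnorm (p + q) = (\<Sum>i\<le>N. norm (coeff p i + coeff q i))"
    by (simp add: pnorm_eq_sum)
  also have "\<dots> \<le> (\<Sum>i\<le>N. norm (coeff p i) + norm (coeff q i))"
    by (intro sum_mono norm_triangle_ineq)
  also have "\<dots> = pnorm p + pnorm q"
    by (simp add: pnorm_eq_sum[of p N] pnorm_eq_sum[of q N] N_def sum.distrib)
  finally show ?thesis .
qed

lemma pnorm_smult: "pnorm (Polynomial.smult c p) = norm c * pnorm p"
proof -
  have "pnorm (Polynomial.smult c p) = (\<Sum>i\<le>degree p. norm (coeff (Polynomial.smult c p) i))"
    by (intro pnorm_eq_sum degree_smult_le)
  then show ?thesis
    by (simp add: pnorm_def norm_mult sum_distrib_left)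
qed

lemma pnorm_diff_triangle: "pnorm (p - q) \<le> pnorm p + pnorm q"
  using pnorm_triangle[of p "Polynomial.smult (- 1) q"] pnorm_smult[of "- 1" q] by simp

lemma pnorm_pCons: "pnorm (pCons a p) = norm a + pnorm p"
proof -
  have "pnorm (pCons a p) = (\<Sum>i\<le>Suc (degree p). norm (coeff (pCons a p) i))"
    by (intro pnorm_eq_sum degree_pCons_le)
  then show ?thesis
    by (simp add: pnorm_def sum.atMost_Suc_shift del: sum.atMost_Suc)
qed

text \<open>For the l1 norm this holds with constant 1 whatever the degrees, which keeps the
  constants of the later fixed point iteration explicit.\<close>

lemma pnorm_mult: "pnorm (p * q) \<le> pnorm p * pnorm q"
proof (induction p)
  case (pCons a p)
  have "pnorm (pCons a p * q) \<le> pnorm (Polynomial.smult a q) + pnorm (pCons 0 (p * q))"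
    by (simp add: mult_pCons_left pnorm_triangle)
  also have "\<dots> \<le> norm a * pnorm q + pnorm p * pnorm q"
    using pCons.IH by (simp add: pnorm_smult pnorm_pCons)
  finally show ?case
    by (simp add: pnorm_pCons algebra_simps)
qed simp

lemma pnorm_sum: "pnorm (\<Sum>i\<in>I. p i) \<le> (\<Sum>i\<in>I. pnorm (p i))"
proof (induction I rule: infinite_finite_induct)
  case (insert x F)
  then show ?case using pnorm_triangle[of "p x" "\<Sum>i\<in>F. p i"] by auto
qed auto

text \<open>Reducing \<open>b * E\<close> modulo \<open>A\<close> bounds the degree of
  \<open>u\<close>; the quotient is moved into \<open>v\<close>, whose degree is then read off from
  \<open>v * A = E - u * B\<close>.\<close>

lemma bezout_bounded_degree:
  fixes A B E :: "complex poly"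
  assumes bez: "a * A + b * B = 1"
    and deg: "degree A > 0" "degree B > 0"
    and E: "degree E < degree A + degree B"
  shows "\<exists>u v. degree u < degree A \<and> degree v < degree B \<and> u * B + v * A = E"
proof -
  have nz: "A \<noteq> 0" "B \<noteq> 0"
    using deg by auto
  define u where "u = (b * E) mod A"
  define v where "v = a * E + (b * E div A) * B"
  have du: "degree u < degree A"
    unfolding u_def using degree_mod_less[OF nz(1), of "b * E"] deg by auto
  have dm: "A * (b * E div A) + (b * E) mod A = b * E"
    by (rule mult_div_mod_eq)
  have "u * B + v * A = (A * (b * E div A) + (b * E) mod A) * B + a * E * A"
    unfolding u_def v_def by (simp only: algebra_simps)
  also have "\<dots> = (a * A + b * B) * E"
    unfolding dm by (simp only: algebra_simps)
  finally have eq: "u * B + v * A = E"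
    by (simp add: bez)
  have "degree v < degree B"
  proof (cases "v = 0")
    case False
    have "degree (u * B) < degree A + degree B"
      using du degree_mult_le[of u B] by linarith
    then have "degree (E - u * B) < degree A + degree B"
      using E by (simp add: degree_diff_less)
    moreover have "E - u * B = v * A"
      using eq by (simp add: algebra_simps)
    ultimately have "degree (v * A) < degree A + degree B"
      by simp
    then show ?thesis
      using False nz by (simp add: degree_mult_eq)
  qed (use deg in simp)
  then show ?thesis
    using du eq by blast
qed

text \<open>Solving once for each monomial and combining the solutions with the coefficients of
  \<open>E\<close> gives operators that are linear by construction; boundedness and preservation of
  holomorphy then reduce to finitely many fixed polynomials.\<close>

lemma bezout_operators:
  fixes A B :: "complex poly"
  assumes bez: "a * A + b * B = 1" and deg: "degree A > 0" "degree B > 0"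
  obtains SU SV :: "complex poly \<Rightarrow> complex poly" and M :: real
  where "M > 0"
    and "\<And>E. degree (SU E) < degree A" and "\<And>E. degree (SV E) < degree B"
    and "\<And>E. degree E < degree A + degree B \<Longrightarrow> SU E * B + SV E * A = E"
    and "\<And>E F. SU (E - F) = SU E - SU F" and "\<And>E F. SV (E - F) = SV E - SV F"
    and "\<And>E. pnorm (SU E) \<le> M * pnorm E" and "\<And>E. pnorm (SV E) \<le> M * pnorm E"
    and "\<And>P S. holo_poly P S \<Longrightarrow> holo_poly (\<lambda>z. SU (P z)) S"
    and "\<And>P S. holo_poly P S \<Longrightarrow> holo_poly (\<lambda>z. SV (P z)) S"
proof -
  define N where "N = degree A + degree B"
  have "\<forall>i. \<exists>u v. i < N \<longrightarrow> degree u < degree A \<and> degree v < degree B \<and> u * B + v * A = monom 1 i"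
    using bezout_bounded_degree[OF bez deg] by (metis N_def degree_monom_eq one_neq_zero)
  then obtain U V where UV: "\<And>i. i < N \<Longrightarrow> degree (U i) < degree A"
      "\<And>i. i < N \<Longrightarrow> degree (V i) < degree B" "\<And>i. i < N \<Longrightarrow> U i * B + V i * A = monom 1 i"
    by metis
  define SU where "SU E = (\<Sum>i<N. Polynomial.smult (coeff E i) (U i))" for E
  define SV where "SV E = (\<Sum>i<N. Polynomial.smult (coeff E i) (V i))" for E
  \<comment> \<open>The summand 1 makes \<open>M\<close> positive, since it will be a
    divisor.\<close>
  define M where "M = 1 + (\<Sum>i<N. pnorm (U i)) + (\<Sum>i<N. pnorm (V i))"
  have sums: "(\<Sum>i<N. pnorm (U i)) \<ge> 0" "(\<Sum>i<N. pnorm (V i)) \<ge> 0"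
    by (auto intro: sum_nonneg)
  have bound: "pnorm (\<Sum>i<N. Polynomial.smult (coeff E i) (W i)) \<le> (\<Sum>i<N. pnorm (W i)) * pnorm E" for E W
  proof -
    have "pnorm (\<Sum>i<N. Polynomial.smult (coeff E i) (W i)) \<le> (\<Sum>i<N. pnorm (W i) * pnorm E)"
      by (rule order_trans[OF pnorm_sum], intro sum_mono)
        (auto simp: pnorm_smult mult.commute[of "norm _"] intro!: mult_left_mono norm_coeff_le_pnorm)
    then show ?thesis by (simp add: sum_distrib_right)
  qed
  show thesis
  proof
    show "M > 0" using sums by (simp add: M_def)
    fix E F :: "complex poly"
    show "degree (SU E) < degree A"
      unfolding SU_def using UV(1) deg by (intro degree_sum_less) (auto intro: le_less_trans[OF degree_smult_le])
    show "degree (SV E) < degree B"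
      unfolding SV_def using UV(2) deg by (intro degree_sum_less) (auto intro: le_less_trans[OF degree_smult_le])
    show "SU (E - F) = SU E - SU F" "SV (E - F) = SV E - SV F"
      by (simp_all add: SU_def SV_def smult_diff_left sum_subtractf)
    have "(\<Sum>i<N. pnorm (U i)) * pnorm E \<le> M * pnorm E" "(\<Sum>i<N. pnorm (V i)) * pnorm E \<le> M * pnorm E"
      using sums by (auto simp: M_def intro!: mult_right_mono)
    then show "pnorm (SU E) \<le> M * pnorm E" "pnorm (SV E) \<le> M * pnorm E"
      using bound[of E U] bound[of E V] by (auto simp: SU_def SV_def)
    assume E: "degree E < degree A + degree B"
    have "SU E * B + SV E * A = (\<Sum>i<N. Polynomial.smult (coeff E i) (U i * B + V i * A))"
      by (simp add: SU_def SV_def sum_distrib_right smult_add_right sum.distrib)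
    also have "\<dots> = (\<Sum>i<N. monom (coeff E i) i)"
      using UV(3) by (intro sum.cong) (auto simp: smult_monom)
    also have "\<dots> = E"
      using poly_as_sum_of_monoms'[of E "N - 1"] E by (cases N) (auto simp: N_def lessThan_Suc_atMost)
    finally show "SU E * B + SV E * A = E" .
  next
    fix P S assume "holo_poly P S"
    then show "holo_poly (\<lambda>z. SU (P z)) S" "holo_poly (\<lambda>z. SV (P z)) S"
      unfolding SU_def SV_def by (auto intro!: holo_poly_sum holo_poly_smult holo_poly_const holo_polyD)
  qed
qed

text \<open>The increments are dominated by a geometric series uniformly in \<open>z\<close>, so by
  the Weierstrass test each coefficient has a holomorphic limit. The degree bound, uniform in
  \<open>k\<close> and \<open>z\<close>, lets finitely many of these limits be assembled into a
  polynomial.\<close>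

lemma holo_poly_geometric_limit:
  assumes S: "open S" and hol: "\<And>k. holo_poly (u k) S"
    and deg: "\<And>k z. z \<in> S \<Longrightarrow> degree (u k z) < p"
    and step: "\<And>k z. z \<in> S \<Longrightarrow> pnorm (u (Suc k) z - u k z) \<le> C * (1/2) ^ k"
    and start: "\<And>z. z \<in> S \<Longrightarrow> u 0 z = 0"
  obtains U where "holo_poly U S" "\<And>z. z \<in> S \<Longrightarrow> degree (U z) < p"
    "\<And>z i. z \<in> S \<Longrightarrow> (\<lambda>k. coeff (u k z) i) \<longlonglongrightarrow> coeff (U z) i"
proof -
  define l where "l i z = (\<Sum>k. coeff (u (Suc k) z - u k z) i)" for i z
  have tel: "(\<Sum>k<n. coeff (u (Suc k) z - u k z) i) = coeff (u n z) i" if "z \<in> S" for n z i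
    using start[OF that] by (induction n) auto
  have "summable (\<lambda>k. C * (1/2) ^ k :: real)"
    by (intro summable_mult summable_geometric) auto
  then have "uniform_limit S (\<lambda>n z. \<Sum>k<n. coeff (u (Suc k) z - u k z) i) (l i) sequentially" for i
    unfolding l_def
    by (intro Weierstrass_m_test[where M="\<lambda>k. C * (1/2) ^ k"])
      (auto intro: order_trans[OF norm_coeff_le_pnorm step] simp del: coeff_diff)
  then have ul: "uniform_limit S (\<lambda>n z. coeff (u n z) i) (l i) sequentially" for i
    by (rule uniform_limit_cong'[THEN iffD1, rotated 2]) (auto simp: tel simp del: coeff_diff)
  have hl: "l i holomorphic_on S" for i
  proof (rule holomorphic_uniform_sequence[OF S])
    show "(\<lambda>z. coeff (u n z) i) holomorphic_on S" for n
      using hol by (rule holo_polyD)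
    fix z assume "z \<in> S"
    then obtain d where "d > 0" "cball z d \<subseteq> S"
      using S open_contains_cball by blast
    then show "\<exists>d>0. cball z d \<subseteq> S \<and> uniform_limit (cball z d) (\<lambda>n z. coeff (u n z) i) (l i) sequentially"
      using ul uniform_limit_on_subset by blast
  qed
  have lim: "(\<lambda>k. coeff (u k z) i) \<longlonglongrightarrow> l i z" if "z \<in> S" for z i
    using tendsto_uniform_limitI[OF ul that] .
  define U where "U z = (\<Sum>i<p. monom (l i z) i)" for z
  have cU: "coeff (U z) i = (if i < p then l i z else 0)" for z i
    by (simp add: U_def coeff_sum)
  show thesis
  proof
    show "holo_poly U S"
      unfolding holo_poly_def cU
    proof
      fix k show "(\<lambda>z. if k < p then l k z else 0) holomorphic_on S"
        using hl[of k] by (cases "k < p") auto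
    qed
    fix z assume z: "z \<in> S"
    have "p > 0" using deg[OF z] by (metis not_less0 gr0I)
    then show "degree (U z) < p"
      by (intro degree_lessI) (auto simp: cU)
    fix i
    show "(\<lambda>k. coeff (u k z) i) \<longlonglongrightarrow> coeff (U z) i"
    proof (cases "i < p")
      case False
      then have "coeff (u k z) i = 0" for k
        using deg[OF z, of k] by (simp add: coeff_eq_0)
      then show ?thesis using False by (simp add: cU)
    qed (simp add: cU lim[OF z])
  qed
qed

lemma tendsto_coeff_mult:
  fixes P Q :: "nat \<Rightarrow> complex poly"
  assumes "\<And>i. (\<lambda>k. coeff (P k) i) \<longlonglongrightarrow> coeff p i" "\<And>i. (\<lambda>k. coeff (Q k) i) \<longlonglongrightarrow> coeff q i"
  shows "(\<lambda>k. coeff (P k * Q k) i) \<longlonglongrightarrow> coeff (p * q) i"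
  unfolding coeff_mult by (intro tendsto_sum tendsto_mult assms)

text \<open>With \<open>Q = A + u\<close> and \<open>R = B + v\<close> the equation \<open>P z = Q * R\<close> reads
  \<open>u * B + v * A = (P z - P 0) - u * v\<close>. Bezout's identity solves the left-hand side for
  \<open>(u, v)\<close>, and near \<open>z = 0\<close> the resulting fixed point iteration is a contraction, uniformly
  in \<open>z\<close>; so the limit is holomorphic.\<close>

lemma holomorphic_factorization:
  assumes r: "r > 0" and hol: "holo_poly P (ball 0 r)"
    and monic: "\<And>z. z \<in> ball 0 r \<Longrightarrow> degree (P z) = p + q \<and> coeff (P z) (p + q) = 1"
    and P0: "P 0 = A * B" and A: "degree A = p" "coeff A p = 1" and B: "degree B = q" "coeff B q = 1"
    and bez: "a * A + b * B = 1" and pq: "p > 0" "q > 0"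
  obtains s Q R where "0 < s" "s \<le> r" "holo_poly Q (ball 0 s)" "holo_poly R (ball 0 s)"
    "\<And>z. z \<in> ball 0 s \<Longrightarrow> P z = Q z * R z"
    "\<And>z. z \<in> ball 0 s \<Longrightarrow> degree (Q z) = p \<and> coeff (Q z) p = 1"
    "\<And>z. z \<in> ball 0 s \<Longrightarrow> degree (R z) = q \<and> coeff (R z) q = 1"
proof (rule bezout_operators[OF bez, unfolded A(1) B(1), OF pq])
  fix SU SV M
  assume M: "M > 0"
    and degS: "\<And>E. degree (SU E) < p" "\<And>E. degree (SV E) < q"
    and solve: "\<And>E. degree E < p + q \<Longrightarrow> SU E * B + SV E * A = E"
    and Sdiff: "\<And>E F. SU (E - F) = SU E - SU F" "\<And>E F. SV (E - F) = SV E - SV F"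
    and Sbd: "\<And>E. pnorm (SU E) \<le> M * pnorm E" "\<And>E. pnorm (SV E) \<le> M * pnorm E"
    and Shol: "\<And>P S. holo_poly P S \<Longrightarrow> holo_poly (\<lambda>z. SU (P z)) S"
      "\<And>P S. holo_poly P S \<Longrightarrow> holo_poly (\<lambda>z. SV (P z)) S"
  \<comment> \<open>\<open>\<delta>\<close> is the radius of the ball that the iteration preserves.
    With \<open>M * \<delta> = 1 / 4\<close>, the error and the product \<open>u * v\<close> each
    contribute at most \<open>\<delta> / 4\<close> to the next iterate, and the two increments
    together shrink by the factor 2 / 4.\<close>
  define \<delta> where "\<delta> = 1 / (4 * M)"
  have \<delta>: "\<delta> > 0" "M * \<delta> = 1 / 4"
    using M by (auto simp: \<delta>_def)
  define E where "E z = P z - P 0" for z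
  have holE: "holo_poly E (ball 0 r)"
    unfolding E_def by (intro holo_poly_diff holo_poly_const hol)
  \<comment> \<open>The leading terms of two monic polynomials cancel, so \<open>E z\<close> lies in
    the range where \<open>SU\<close> and \<open>SV\<close> solve the equation.\<close>
  have degE: "degree (E z) < p + q" if "z \<in> ball 0 r" for z
  proof (rule degree_lessI)
    show "\<forall>k\<ge>p + q. coeff (E z) k = 0"
    proof (intro allI impI)
      fix k assume "k \<ge> p + q"
      then show "coeff (E z) k = 0"
        using monic[OF that] monic[of 0] r
        by (cases "k = p + q") (auto simp: E_def coeff_eq_0)
    qed
  qed (use pq in auto)
  have \<epsilon>: "\<delta> * (1 / 4) * (1 / M) > 0"
    using \<delta> M by simp
  \<comment> \<open>This is \<open>pnorm (E z)\<close> with a summation range independent of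
    \<open>z\<close>, which makes its continuity visible although the degree of \<open>E z\<close>
    may jump.\<close>
  define g where "g z = (\<Sum>i\<le>p + q. norm (coeff (E z) i))" for z
  have "continuous_on (ball 0 r) g"
    unfolding g_def by (intro continuous_intros holomorphic_on_imp_continuous_on holo_polyD[OF holE])
  then have "\<forall>e>0. \<exists>d>0. \<forall>z\<in>ball 0 r. dist z 0 < d \<longrightarrow> dist (g z) (g 0) < e"
    unfolding continuous_on_iff by (rule bspec) (use r in simp)
  from this[rule_format, OF \<epsilon>] obtain d where d: "d > 0"
    "\<And>z. z \<in> ball 0 r \<Longrightarrow> dist z 0 < d \<Longrightarrow> dist (g z) (g 0) < \<delta> * (1 / 4) * (1 / M)"
    by blast
  define s where "s = min r d"
  have s: "s > 0" "s \<le> r" "ball 0 s \<subseteq> (ball 0 r :: complex set)"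
    using r d by (auto simp: s_def)
  have smallE: "M * pnorm (E z) \<le> \<delta> / 4" if "z \<in> ball 0 s" for z
  proof -
    have "z \<in> ball 0 r" "dist z 0 < d"
      using that by (auto simp: s_def dist_commute)
    then have "g z < \<delta> * (1 / 4) * (1 / M)"
      using d(2)[of z] by (auto simp: g_def E_def dist_real_def)
    moreover have "g z = pnorm (E z)"
      unfolding g_def using degE[OF \<open>z \<in> ball 0 r\<close>] by (intro pnorm_eq_sum[symmetric]) simp
    ultimately show ?thesis
      using M by (simp add: field_simps)
  qed
  \<comment> \<open>Each iterate of \<open>u\<close> uses the previous \<open>v\<close> and
    conversely, hence a recursion on pairs. The start (0, 0) is the known factorization
    \<open>A * B\<close> at the base point.\<close>
  define w where "w = rec_nat (\<lambda>z. (0, 0))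
    (\<lambda>k w z. (SU (E z - fst (w z) * snd (w z)), SV (E z - fst (w z) * snd (w z))))"
  define u where "u k z = fst (w k z)" for k z
  define v where "v k z = snd (w k z)" for k z
  have u0: "u 0 z = 0" and v0: "v 0 z = 0" for z
    by (simp_all add: u_def v_def w_def)
  have uS: "u (Suc k) z = SU (E z - u k z * v k z)" and vS: "v (Suc k) z = SV (E z - u k z * v k z)" for k z
    by (simp_all add: u_def v_def w_def)
  have holuv: "holo_poly (u k) (ball 0 s) \<and> holo_poly (v k) (ball 0 s)" for k
  proof (induction k)
    case 0
    then show ?case using u0 v0 holo_poly_const by simp
  next
    case (Suc k)
    have "holo_poly (\<lambda>z. E z - u k z * v k z) (ball 0 s)"
      using Suc by (intro holo_poly_diff holo_poly_mult holo_poly_subset[OF holE] s) auto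
    then show ?case
      unfolding uS vS by (simp add: Shol)
  qed
  have degu: "degree (u k z) < p" for k z
    using pq degS by (cases k) (auto simp: u0 uS)
  have degv: "degree (v k z) < q" for k z
    using pq degS by (cases k) (auto simp: v0 vS)
  have bd: "pnorm (u k z) \<le> \<delta> \<and> pnorm (v k z) \<le> \<delta>" if z: "z \<in> ball 0 s" for k z
  proof (induction k)
    case (Suc k)
    have "pnorm (E z - u k z * v k z) \<le> pnorm (E z) + pnorm (u k z) * pnorm (v k z)"
      using pnorm_diff_triangle[of "E z" "u k z * v k z"] pnorm_mult[of "u k z" "v k z"] by linarith
    also have "\<dots> \<le> pnorm (E z) + \<delta> * \<delta>"
      using Suc \<delta> by (intro add_left_mono mult_mono) auto
    finally have "M * pnorm (E z - u k z * v k z) \<le> M * (pnorm (E z) + \<delta> * \<delta>)"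
      using M by simp
    also have "\<dots> = M * pnorm (E z) + (M * \<delta>) * \<delta>"
      by (simp add: algebra_simps)
    also have "\<dots> \<le> \<delta>"
      unfolding \<delta>(2) using smallE[OF z] \<delta>(1) by linarith
    finally show ?case
      unfolding uS vS using Sbd order_trans by blast
  qed (use \<delta> in \<open>simp add: u0 v0\<close>)
  \<comment> \<open>The change of \<open>u * v\<close> involves the increments of both factors, so
    only their sum can be estimated inductively. The constant \<open>2 * \<delta>\<close> is the
    bound on the first pair of iterates.\<close>
  have step: "pnorm (u (Suc k) z - u k z) + pnorm (v (Suc k) z - v k z) \<le> (2 * \<delta>) * (1/2) ^ k"
    if z: "z \<in> ball 0 s" for k z
  proof (induction k)
    case 0
    then show ?case using bd[OF z, of "Suc 0"] by (simp add: u0 v0)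
  next
    case (Suc k)
    define D where "D = u k z * v k z - u (Suc k) z * v (Suc k) z"
    define du where "du = pnorm (u (Suc k) z - u k z)"
    define dv where "dv = pnorm (v (Suc k) z - v k z)"
    have "- D = u k z * (v (Suc k) z - v k z) + (u (Suc k) z - u k z) * v (Suc k) z"
      by (simp add: D_def algebra_simps)
    then have "pnorm D = pnorm (u k z * (v (Suc k) z - v k z) + (u (Suc k) z - u k z) * v (Suc k) z)"
      using pnorm_smult[of "- 1" D] by simp
    also have "\<dots> \<le> pnorm (u k z) * dv + du * pnorm (v (Suc k) z)"
      unfolding du_def dv_def by (intro order_trans[OF pnorm_triangle] add_mono pnorm_mult)
    also have "\<dots> \<le> \<delta> * dv + du * \<delta>"
      using bd[OF z, of k] bd[OF z, of "Suc k"] \<delta> by (intro add_mono mult_mono) (auto simp: du_def dv_def)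
    finally have "M * pnorm D \<le> M * (\<delta> * dv + du * \<delta>)"
      using M by simp
    also have "\<dots> = (M * \<delta>) * (du + dv)"
      by (simp add: algebra_simps)
    finally have MD: "M * pnorm D \<le> (du + dv) / 4"
      unfolding \<delta>(2) by simp
    have D: "D = (E z - u (Suc k) z * v (Suc k) z) - (E z - u k z * v k z)"
      by (simp add: D_def)
    have SD: "u (Suc (Suc k)) z - u (Suc k) z = SU D" "v (Suc (Suc k)) z - v (Suc k) z = SV D"
      by (simp_all only: uS[of "Suc k"] uS[of k] vS[of "Suc k"] vS[of k] D Sdiff)
    have "pnorm (u (Suc (Suc k)) z - u (Suc k) z) + pnorm (v (Suc (Suc k)) z - v (Suc k) z) \<le> (du + dv) / 2"
      unfolding SD using Sbd[of D] MD by linarith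
    then show ?case
      using Suc by (simp add: du_def dv_def)
  qed
  have stepu: "pnorm (u (Suc k) z - u k z) \<le> (2 * \<delta>) * (1/2) ^ k"
    and stepv: "pnorm (v (Suc k) z - v k z) \<le> (2 * \<delta>) * (1/2) ^ k" if "z \<in> ball 0 s" for k z
    using step[OF that, of k] pnorm_nonneg[of "u (Suc k) z - u k z"] pnorm_nonneg[of "v (Suc k) z - v k z"]
    by linarith+
  obtain U where U: "holo_poly U (ball 0 s)" "\<And>z. z \<in> ball 0 s \<Longrightarrow> degree (U z) < p"
    "\<And>z i. z \<in> ball 0 s \<Longrightarrow> (\<lambda>k. coeff (u k z) i) \<longlonglongrightarrow> coeff (U z) i"
    using holo_poly_geometric_limit[of "ball 0 s" u p "2 * \<delta>"] holuv degu stepu u0 by auto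
  obtain V where V: "holo_poly V (ball 0 s)" "\<And>z. z \<in> ball 0 s \<Longrightarrow> degree (V z) < q"
    "\<And>z i. z \<in> ball 0 s \<Longrightarrow> (\<lambda>k. coeff (v k z) i) \<longlonglongrightarrow> coeff (V z) i"
    using holo_poly_geometric_limit[of "ball 0 s" v q "2 * \<delta>"] holuv degv stepv v0 by auto
  have eq: "U z * B + V z * A = E z - U z * V z" if z: "z \<in> ball 0 s" for z
  proof (rule poly_eqI)
    fix i
    have "(\<lambda>k. coeff (u (Suc k) z * B) i + coeff (v (Suc k) z * A) i)
        \<longlonglongrightarrow> coeff (U z * B) i + coeff (V z * A) i"
      by (intro tendsto_add tendsto_coeff_mult LIMSEQ_Suc[OF U(3)[OF z]] LIMSEQ_Suc[OF V(3)[OF z]] tendsto_const)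
    moreover have "(\<lambda>k. coeff (E z) i - coeff (u k z * v k z) i) \<longlonglongrightarrow> coeff (E z) i - coeff (U z * V z) i"
      by (intro tendsto_diff tendsto_coeff_mult U(3)[OF z] V(3)[OF z] tendsto_const)
    moreover have "u (Suc k) z * B + v (Suc k) z * A = E z - u k z * v k z" for k
    proof -
      have "degree (u k z * v k z) < p + q"
        using degree_mult_le[of "u k z" "v k z"] degu[of k z] degv[of k z] by linarith
      then show ?thesis
        unfolding uS vS using degE[of z] z s(3) by (intro solve degree_diff_less) auto
    qed
    then have "coeff (u (Suc k) z * B) i + coeff (v (Suc k) z * A) i = coeff (E z) i - coeff (u k z * v k z) i" for k
      by (metis coeff_add coeff_diff)
    ultimately have "coeff (U z * B) i + coeff (V z * A) i = coeff (E z) i - coeff (U z * V z) i"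
      using LIMSEQ_unique by simp
    then show "coeff (U z * B + V z * A) i = coeff (E z - U z * V z) i"
      by simp
  qed
  have monic_add: "degree (X + Y) = n \<and> coeff (X + Y) n = 1"
    if "degree X = n" "coeff X n = 1" "degree Y < n" for X Y :: "complex poly" and n
    using that by (simp add: degree_add_eq_left coeff_eq_0)
  show thesis
  proof
    show "s > 0" "s \<le> r" using s by auto
    show "holo_poly (\<lambda>z. A + U z) (ball 0 s)" "holo_poly (\<lambda>z. B + V z) (ball 0 s)"
      using U V by (auto intro!: holo_poly_add holo_poly_const)
    fix z :: complex assume z: "z \<in> ball 0 s"
    show "degree (A + U z) = p \<and> coeff (A + U z) p = 1" "degree (B + V z) = q \<and> coeff (B + V z) q = 1"
      using monic_add A B U(2)[OF z] V(2)[OF z] by auto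
    have "(A + U z) * (B + V z) = A * B + (U z * B + V z * A) + U z * V z"
      by (simp add: algebra_simps)
    then show "P z = (A + U z) * (B + V z)"
      by (simp add: eq[OF z] E_def P0)
  qed
qed

section \<open>Polynomials with real roots\<close>

text \<open>A list records roots with multiplicity and can be replaced by a list of functions
  evaluated at a parameter, which is how holomorphic roots are stated.\<close>

definition linprod :: "complex list \<Rightarrow> complex poly" where
  "linprod as = (\<Prod>a\<leftarrow>as. [:- a, 1:])"

lemma linprod_simps [simp]:
  "linprod [] = 1" "linprod (a # as) = [:- a, 1:] * linprod as"
  "linprod (as @ bs) = linprod as * linprod bs"
  by (simp_all add: linprod_def)

lemma degree_linprod [simp]: "degree (linprod as) = length as"
  unfolding linprod_def by (rule degree_linear_factors)

lemma coeff_linprod_length [simp]: "coeff (linprod as) (length as) = 1"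
proof -
  have "monic (linprod as)"
    unfolding linprod_def by (rule monic_prod_list) auto
  then show ?thesis by simp
qed

lemma coeff_linprod_Cons:
  "coeff (linprod (a # as)) k = (case k of 0 \<Rightarrow> 0 | Suc i \<Rightarrow> coeff (linprod as) i) - a * coeff (linprod as) k"
  by (simp add: mult_pCons_left coeff_pCons split: nat.split)

lemma coeff_linprod_penultimate:
  "as \<noteq> [] \<Longrightarrow> coeff (linprod as) (length as - 1) = - sum_list as"
proof (induction as)
  case (Cons a as)
  then show ?case
    by (cases as) (auto simp: coeff_linprod_Cons coeff_eq_0 simp del: linprod_simps(2))
qed simp

text \<open>Newton's identity 2 e_2 = e_1^2 - p_2. When the roots have sum zero, this single
  coefficient determines the sum of their squares.\<close>

lemma coeff_linprod_antepenultimate: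
  "length as \<ge> 2 \<Longrightarrow>
    2 * coeff (linprod as) (length as - 2) = (sum_list as)\<^sup>2 - (\<Sum>a\<leftarrow>as. a\<^sup>2)"
proof (induction as)
  case (Cons a as)
  show ?case
  proof (cases "length as \<ge> 2")
    case True
    then obtain k where k: "length as = Suc (Suc k)"
      by (metis One_nat_def Suc_1 Suc_le_D Suc_le_mono)
    have "coeff (linprod as) (Suc k) = - sum_list as"
      using coeff_linprod_penultimate[of as] k by (cases "as = []") auto
    moreover have "2 * coeff (linprod as) k = (sum_list as)\<^sup>2 - (\<Sum>a\<leftarrow>as. a\<^sup>2)"
      using Cons.IH k by simp
    ultimately show ?thesis
      by (simp add: coeff_linprod_Cons k algebra_simps power2_eq_square del: linprod_simps(2))
  next
    case False
    with Cons.prems obtain b where "as = [b]"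
      by (cases as) (auto simp: Suc_le_eq)
    then show ?thesis
      by (simp add: power2_eq_square algebra_simps)
  qed
qed simp

text \<open>Up to sign the coefficient at \<open>j\<close> is the elementary symmetric polynomial of
  degree \<open>length as - j\<close> in the roots, hence homogeneous. Read backwards: dividing
  coefficients by these powers divides all roots by \<open>c\<close>.\<close>

lemma coeff_linprod_scale:
  "j \<le> length as \<Longrightarrow>
    coeff (linprod (map (\<lambda>a. c * a) as)) j = c ^ (length as - j) * coeff (linprod as) j"
proof (induction as arbitrary: j)
  case (Cons a as)
  show ?case
  proof (cases j)
    case 0
    then show ?thesis
      using Cons.IH[of 0] by (simp add: coeff_linprod_Cons del: linprod_simps(2))
  next
    case (Suc i)
    show ?thesis
    proof (cases "Suc i \<le> length as")
      case True
      then have "length as - i = Suc (length as - Suc i)"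
        by simp
      then show ?thesis
        using Cons.IH[of i] Cons.IH[of "Suc i"] True
        by (simp add: coeff_linprod_Cons Suc algebra_simps del: linprod_simps(2))
    next
      case False
      then have "i = length as"
        using Cons.prems Suc by simp
      then show ?thesis
        using Cons.IH[of i] by (simp add: coeff_linprod_Cons Suc coeff_eq_0 del: linprod_simps(2))
    qed
  qed
qed simp

lemma pcompose_linprod: "pcompose (linprod as) [:d, 1:] = linprod (map (\<lambda>a. a - d) as)"
proof (induction as)
  case Nil
  then show ?case by (simp add: pcompose_1)
next
  case (Cons a as)
  then show ?case by (simp add: pcompose_mult pcompose_pCons del: mult_pCons_left)
qed

lemma pnorm_linprod:
  assumes "\<And>a. a \<in> set as \<Longrightarrow> norm a \<le> C" "C \<ge> 0"
  shows "pnorm (linprod as) \<le> (1 + C) ^ length as"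
  using assms
proof (induction as)
  case Nil
  then show ?case by (simp add: pnorm_def)
next
  case (Cons a as)
  have "pnorm (linprod (a # as)) \<le> pnorm [:- a, 1:] * pnorm (linprod as)"
    unfolding linprod_simps by (rule pnorm_mult)
  also have "\<dots> \<le> (1 + C) * (1 + C) ^ length as"
    using Cons by (intro mult_mono) (auto simp: pnorm_pCons)
  finally show ?case by simp
qed

lemma poly_linprod_eq_0_iff: "poly (linprod as) x = 0 \<longleftrightarrow> x \<in> set as"
  by (induction as) auto

text \<open>A quantitative form of real-rootedness. Unlike the absence of nonreal roots, an
  inequality passes to limits; this is how real-rootedness of the rescaled family reaches the
  parameter 0.\<close>

lemma poly_linprod_lower_bound:
  assumes "\<And>a. a \<in> set as \<Longrightarrow> a \<in> \<real>"
  shows "norm (poly (linprod as) w) \<ge> \<bar>Im w\<bar> ^ length as"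
  using assms
proof (induction as)
  case (Cons a as)
  have "Im a = 0"
    using Cons.prems complex_is_Real_iff by simp
  then have "\<bar>Im w\<bar> \<le> norm (w - a)"
    using abs_Im_le_cmod[of "w - a"] by simp
  moreover have "\<bar>Im w\<bar> ^ length as \<le> norm (poly (linprod as) w)"
    using Cons by simp
  moreover have "poly (linprod (a # as)) w = (w - a) * poly (linprod as) w"
    by (simp add: algebra_simps)
  ultimately show ?case
    by (simp add: norm_mult mult_mono del: linprod_simps)
qed simp

lemma monic_eq_linprod:
  assumes "degree p = n" "coeff p n = 1"
  obtains as where "p = linprod as" "length as = n"
  using fundamental_theorem_algebra_factorized[of p] assms by (auto simp: linprod_def)

text \<open>Division of \<open>B\<close> by \<open>X\<close> leaves the nonzero constant
  \<open>\<beta>\<close>, so 1 is a multiple of \<open>B - X * q\<close>. Multiplying the term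
  \<open>a * X ^ p\<close> of the inductive identity by this 1 produces one more factor
  \<open>X\<close> and otherwise only multiples of \<open>B\<close>.\<close>

lemma bezout_linear_power:
  fixes B :: "complex poly"
  assumes "poly B c \<noteq> 0"
  shows "\<exists>a b. a * [:- c, 1:] ^ p + b * B = 1"
proof (induction p)
  case 0
  show ?case by (rule exI[of _ 1], rule exI[of _ 0]) simp
next
  case (Suc p)
  define X where "X = [:- c, 1:]"
  define \<beta> where "\<beta> = poly B c"
  have "poly (B - [:\<beta>:]) c = 0"
    by (simp add: \<beta>_def)
  then obtain q where q: "B - [:\<beta>:] = X * q"
    unfolding poly_eq_0_iff_dvd X_def by (auto elim: dvdE)
  define k where "k = [:1 / \<beta>:]"
  have "k * [:\<beta>:] = 1"
    using assms by (simp add: k_def \<beta>_def one_pCons)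
  moreover have "[:\<beta>:] = B - X * q"
    using q by (simp add: algebra_simps)
  ultimately have one: "k * (B - X * q) = 1"
    by simp
  from Suc obtain a b where ab: "a * X ^ p + b * B = 1"
    by (auto simp: X_def)
  have "(- (a * k * q)) * X ^ Suc p + (a * X ^ p * k + b) * B = a * X ^ p * (k * (B - X * q)) + b * B"
    by (simp add: algebra_simps)
  also have "\<dots> = 1"
    unfolding one using ab by simp
  finally show ?case
    unfolding X_def by blast
qed

section \<open>Holomorphic functions determined by their values on a real segment\<close>

lemma islimpt_real_ball:
  assumes "r > 0"
  shows "(0::complex) islimpt (of_real ` {t. t \<noteq> 0 \<and> \<bar>t\<bar> < r})"
  unfolding islimpt_approachable
proof (intro allI impI)
  fix e :: real assume "e > 0"
  show "\<exists>x'\<in>complex_of_real ` {t. t \<noteq> 0 \<and> \<bar>t\<bar> < r}. x' \<noteq> 0 \<and> dist x' 0 < e"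
  proof (intro bexI conjI)
    show "complex_of_real (min e r / 2) \<in> of_real ` {t. t \<noteq> 0 \<and> \<bar>t\<bar> < r}"
      using assms \<open>e > 0\<close> by (intro imageI) auto
    show "complex_of_real (min e r / 2) \<noteq> 0" "dist (complex_of_real (min e r / 2)) 0 < e"
      using assms \<open>e > 0\<close> by (auto simp: dist_norm min_def simp flip: of_real_divide)
  qed
qed

text \<open>The hypothesis spares \<open>t = 0\<close> while the conclusion includes 0, so the lemma
  applies to equations obtained by cancelling a power of \<open>t\<close>.\<close>

lemma holomorphic_eq_if_eq_on_reals:
  assumes r: "r > 0" and f: "f holomorphic_on ball 0 r" and g: "g holomorphic_on ball 0 r"
    and eq: "\<And>t::real. t \<noteq> 0 \<Longrightarrow> \<bar>t\<bar> < r \<Longrightarrow> f (of_real t) = g (of_real t)"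
    and z: "z \<in> ball 0 r"
  shows "f z = g z"
proof -
  have "f z - g z = 0"
  proof (rule analytic_continuation[where f="\<lambda>z. f z - g z" and w=z and U="of_real ` {t. t \<noteq> 0 \<and> \<bar>t\<bar> < r}" and \<xi>=0 and S="ball 0 r"])
    show "(\<lambda>z. f z - g z) holomorphic_on ball 0 r"
      using f g by (intro holomorphic_intros)
  qed (use r z eq islimpt_real_ball[OF r] in auto)
  then show ?thesis by simp
qed

lemma holomorphic_cancel_power:
  assumes "r > 0" "f holomorphic_on ball 0 r" "g holomorphic_on ball 0 r"
    and "\<And>z. z \<in> ball 0 r \<Longrightarrow> z ^ d * f z = z ^ d * g z" "z \<in> ball 0 r"
  shows "f z = g z"
  using assms(1-3)
proof (rule holomorphic_eq_if_eq_on_reals)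
  fix t :: real assume "t \<noteq> 0" "\<bar>t\<bar> < r"
  then show "f (of_real t) = g (of_real t)"
    using assms(4)[of "of_real t"] by simp
qed fact

text \<open>The bound is asked for at real points because only there the roots are known to be real.
  It forces \<open>f 0 = 0\<close>; the quotient by \<open>z\<close>, completed by the derivative at
  0, is again holomorphic and satisfies the bound with exponent one less.\<close>

lemma holomorphic_divide_power:
  assumes "r > 0" "f holomorphic_on ball 0 r"
    and "\<And>t::real. t \<noteq> 0 \<Longrightarrow> \<bar>t\<bar> < r \<Longrightarrow> norm (f (of_real t)) \<le> C * \<bar>t\<bar> ^ d"
  shows "\<exists>b. b holomorphic_on ball 0 r \<and> (\<forall>z\<in>ball 0 r. f z = z ^ d * b z)"
  using assms
proof (induction d arbitrary: f)
  case 0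
  then show ?case by auto
next
  case (Suc d)
  have "isCont f 0"
    using holomorphic_on_imp_continuous_on[OF Suc.prems(2)] Suc.prems(1)
    by (simp add: continuous_on_eq_continuous_at)
  then have "isCont (\<lambda>t::real. f (of_real t)) 0"
    using isCont_o2[of 0 complex_of_real f] isCont_of_real by simp
  then have lim: "((\<lambda>t::real. f (of_real t)) \<longlongrightarrow> f 0) (at 0)"
    by (simp add: isCont_def)
  have "((\<lambda>t::real. f (of_real t)) \<longlongrightarrow> 0) (at 0)"
  proof (rule Lim_null_comparison)
    have "eventually (\<lambda>t::real. t \<in> {-r<..<r} \<and> t \<noteq> 0) (at 0)"
      using Suc.prems(1) by (intro eventually_conj eventually_at_in_open'[of "{-r<..<r}"] ) (auto simp: eventually_at_filter)
    then show "\<forall>\<^sub>F t in at 0. norm (f (complex_of_real t)) \<le> C * \<bar>t\<bar> ^ Suc d"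
      by (rule eventually_mono) (use Suc.prems(3) in auto)
    show "((\<lambda>t::real. C * \<bar>t\<bar> ^ Suc d) \<longlongrightarrow> 0) (at 0)"
      by (auto intro!: tendsto_eq_intros)
  qed
  then have f0: "f 0 = 0"
    using lim LIM_unique by blast
  define f1 where "f1 = (\<lambda>z. if z = 0 then deriv f 0 else (f z - f 0) / (z - 0))"
  have hf1: "f1 holomorphic_on ball 0 r"
    unfolding f1_def using Suc.prems(2) by (rule pole_lemma_open) simp
  have f1: "f z = z * f1 z" for z
    using f0 by (simp add: f1_def)
  have "norm (f1 (of_real t)) \<le> C * \<bar>t\<bar> ^ d" if "t \<noteq> 0" "\<bar>t\<bar> < r" for t :: real
    using Suc.prems(3)[OF that] that by (simp add: f1 norm_mult field_simps)
  then obtain b where "b holomorphic_on ball 0 r" "\<forall>z\<in>ball 0 r. f1 z = z ^ d * b z"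
    using Suc.IH[OF Suc.prems(1) hf1] by blast
  then show ?case
    by (auto simp: f1 mult.assoc)
qed

lemma holomorphic_factor_power:
  assumes r: "r > 0" and f: "f holomorphic_on ball 0 r" and nz: "z0 \<in> ball 0 r" "f z0 \<noteq> 0"
  obtains m g s where "0 < s" "s \<le> r" "g holomorphic_on ball 0 s" "g 0 \<noteq> 0"
    "\<And>z. z \<in> ball 0 s \<Longrightarrow> f z = z ^ m * g z"
proof (cases "f 0 = 0")
  case False
  then show thesis
    using that[of r f 0] r f by simp
next
  case True
  have "\<not> f constant_on ball 0 r"
  proof
    assume "f constant_on ball 0 r"
    then obtain y where "\<And>z. z \<in> ball 0 r \<Longrightarrow> f z = y"
      unfolding constant_on_def by blast
    then show False
      using True nz r by (metis centre_in_ball)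
  qed
  then show thesis
  proof (rule holomorphic_factor_zero_nonconstant[OF f open_ball connected_ball, rotated 2])
    fix g s m
    assume *: "0 < m" "0 < s" "ball 0 s \<subseteq> ball 0 r" "g holomorphic_on ball 0 s"
      "\<And>w. w \<in> ball 0 s \<Longrightarrow> f w = (w - 0) ^ m * g w" "\<And>w. w \<in> ball 0 s \<Longrightarrow> g w \<noteq> 0"
    have "g holomorphic_on ball 0 (min r s)"
      using *(4) by (rule holomorphic_on_subset) auto
    then show thesis
      using that[of "min r s" g m] * r by auto
  qed (use True r in auto)
qed

text \<open>For odd \<open>m\<close> the factor t^m changes sign at 0, so the real part of
  \<open>g\<close> is nonpositive to the right and nonnegative to the left of 0. Its imaginary part
  is 0 on both sides, and continuity would give \<open>g 0 = 0\<close>.\<close>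

lemma even_vanishing_order_if_nonpos:
  assumes s: "s > 0" and g: "g holomorphic_on ball 0 s" "g 0 \<noteq> 0"
    and sgn: "\<And>t::real. t \<noteq> 0 \<Longrightarrow> \<bar>t\<bar> < s \<Longrightarrow> \<exists>y\<le>0. of_real t ^ m * g (of_real t) = of_real y"
  shows "even m"
proof (rule ccontr)
  assume "odd m"
  have ev: "eventually (\<lambda>t::real. t \<noteq> 0 \<and> \<bar>t\<bar> < s) (at 0)"
    unfolding eventually_at using s by (intro exI[of _ s]) (auto simp: dist_norm)
  have "isCont g 0"
    using holomorphic_on_imp_continuous_on[OF g(1)] s
    by (simp add: continuous_on_eq_continuous_at)
  then have "isCont (\<lambda>t::real. g (of_real t)) 0"
    using isCont_o2[of 0 complex_of_real g] isCont_of_real by simp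
  then have lim: "((\<lambda>t::real. g (of_real t)) \<longlongrightarrow> g 0) (at 0)"
    by (simp add: isCont_def)
  have key: "Im (g (of_real t)) = 0 \<and> t * Re (g (of_real t)) \<le> 0" if t: "t \<noteq> 0" "\<bar>t\<bar> < s" for t :: real
  proof -
    obtain y where y: "y \<le> 0" "of_real t ^ m * g (of_real t) = of_real y"
      using sgn[OF t] by blast
    have "g (of_real t) = (of_real t ^ m * g (of_real t)) / of_real t ^ m"
      using t by simp
    then have gt: "g (of_real t) = of_real (y / t ^ m)"
      unfolding y by simp
    \<comment> \<open>Expanding by t^m leaves only even powers of \<open>t\<close>, namely
      \<open>t * t ^ m\<close> and the square of \<open>t ^ m\<close>.\<close>
    have "t * (y / t ^ m) = y * (t * t ^ m) / (t ^ m)\<^sup>2"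
      using t by (simp add: power2_eq_square)
    also have "\<dots> \<le> 0"
      using y \<open>odd m\<close> zero_le_even_power[of "Suc m" t]
      by (intro divide_nonpos_nonneg mult_nonpos_nonneg) auto
    finally show ?thesis
      by (simp add: gt)
  qed
  have pos: "Re (g (of_real t)) \<le> 0" if "t > 0 \<and> \<bar>t\<bar> < s" for t :: real
    using key[of t] that by (auto simp: mult_le_0_iff)
  have neg: "Re (g (of_real t)) \<ge> 0" if "t < 0 \<and> \<bar>t\<bar> < s" for t :: real
    using key[of t] that by (auto simp: mult_le_0_iff)
  have "((\<lambda>t::real. Im (g (of_real t))) \<longlongrightarrow> 0) (at 0)"
    by (rule tendsto_eventually, rule eventually_mono[OF ev]) (use key in blast)
  with tendsto_Im[OF lim] have im: "Im (g 0) = 0"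
    using LIM_unique by blast
  have "Re (g 0) \<le> 0"
  proof (rule tendsto_upperbound)
    show "((\<lambda>t::real. Re (g (of_real t))) \<longlongrightarrow> Re (g 0)) (at_right 0)"
      using filterlim_at_split[THEN iffD1, OF tendsto_Re[OF lim]] by simp
    have "eventually (\<lambda>t::real. t > 0 \<and> \<bar>t\<bar> < s) (at_right 0)"
      unfolding eventually_at using s by (intro exI[of _ s]) (auto simp: dist_norm)
    then show "\<forall>\<^sub>F t in at_right 0. Re (g (complex_of_real t)) \<le> 0"
      by (rule eventually_mono) (use pos in blast)
  qed simp
  moreover have "Re (g 0) \<ge> 0"
  proof (rule tendsto_lowerbound)
    show "((\<lambda>t::real. Re (g (of_real t))) \<longlongrightarrow> Re (g 0)) (at_left 0)"
      using filterlim_at_split[THEN iffD1, OF tendsto_Re[OF lim]] by simp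
    have "eventually (\<lambda>t::real. t < 0 \<and> \<bar>t\<bar> < s) (at_left 0)"
      unfolding eventually_at using s by (intro exI[of _ s]) (auto simp: dist_norm)
    then show "\<forall>\<^sub>F t in at_left 0. Re (g (complex_of_real t)) \<ge> 0"
      by (rule eventually_mono) (use neg in blast)
  qed simp
  ultimately show False
    using im g(2) by (simp add: complex_eq_iff)
qed

section \<open>Holomorphic roots of real-rooted families\<close>

text \<open>Polynomials with only real roots are called hyperbolic. At nonreal parameters the roots
  are unrestricted.\<close>

definition hyperbolic_family :: "(complex \<Rightarrow> complex poly) \<Rightarrow> nat \<Rightarrow> real \<Rightarrow> bool" where
  "hyperbolic_family P n r \<longleftrightarrow> r > 0 \<and> holo_poly P (ball 0 r) \<and>
     (\<forall>z\<in>ball 0 r. degree (P z) = n \<and> coeff (P z) n = 1) \<and>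
     (\<forall>t::real. \<bar>t\<bar> < r \<longrightarrow> (\<forall>x. poly (P (of_real t)) x = 0 \<longrightarrow> x \<in> \<real>))"

text \<open>The radius \<open>s\<close> is not tied to that of the family, since every factorization
  and every rescaling may shrink the ball.\<close>

definition splits_near_0 :: "(complex \<Rightarrow> complex poly) \<Rightarrow> bool" where
  "splits_near_0 P \<longleftrightarrow> (\<exists>s>0. \<exists>fs. (\<forall>f\<in>set fs. f holomorphic_on ball 0 s) \<and>
     (\<forall>z\<in>ball 0 s. P z = linprod (map (\<lambda>f. f z) fs)))"

lemma hyperbolic_familyD:
  assumes "hyperbolic_family P n r"
  shows "r > 0" "holo_poly P (ball 0 r)"
    "\<And>z. z \<in> ball 0 r \<Longrightarrow> degree (P z) = n" "\<And>z. z \<in> ball 0 r \<Longrightarrow> coeff (P z) n = 1"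
    "\<And>(t::real) x. \<bar>t\<bar> < r \<Longrightarrow> poly (P (of_real t)) x = 0 \<Longrightarrow> x \<in> \<real>"
  using assms unfolding hyperbolic_family_def by blast+

lemma hyperbolic_family_roots:
  assumes "hyperbolic_family P n r" "\<bar>t\<bar> < r"
  obtains as where "P (of_real t) = linprod as" "length as = n" "\<And>a. a \<in> set as \<Longrightarrow> a \<in> \<real>"
proof -
  have t: "complex_of_real t \<in> ball 0 r"
    using assms by simp
  obtain as where as: "P (of_real t) = linprod as" "length as = n"
    using hyperbolic_familyD[OF assms(1)] t by (metis monic_eq_linprod)
  moreover have "a \<in> \<real>" if "a \<in> set as" for a
    using hyperbolic_familyD(5)[OF assms, of a] that as(1) by (simp add: poly_linprod_eq_0_iff)
  ultimately show thesis
    using that by blast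
qed

lemma splits_near_0_mult:
  assumes "splits_near_0 Q" "splits_near_0 R" "s > 0" "\<And>z. z \<in> ball 0 s \<Longrightarrow> P z = Q z * R z"
  shows "splits_near_0 P"
proof -
  obtain s1 fs where 1: "s1 > 0" "\<And>f. f \<in> set fs \<Longrightarrow> f holomorphic_on ball 0 s1"
    "\<And>z. z \<in> ball 0 s1 \<Longrightarrow> Q z = linprod (map (\<lambda>f. f z) fs)"
    using assms(1) unfolding splits_near_0_def by blast
  obtain s2 gs where 2: "s2 > 0" "\<And>f. f \<in> set gs \<Longrightarrow> f holomorphic_on ball 0 s2"
    "\<And>z. z \<in> ball 0 s2 \<Longrightarrow> R z = linprod (map (\<lambda>f. f z) gs)"
    using assms(2) unfolding splits_near_0_def by blast
  define s3 where "s3 = min s (min s1 s2)"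
  have sub: "ball 0 s3 \<subseteq> (ball 0 s1 :: complex set)" "ball 0 s3 \<subseteq> (ball 0 s2 :: complex set)"
    "ball 0 s3 \<subseteq> (ball 0 s :: complex set)"
    by (auto simp: s3_def)
  show ?thesis
    unfolding splits_near_0_def
  proof (intro exI[of _ s3] conjI exI[of _ "fs @ gs"] ballI)
    show "s3 > 0" using 1 2 assms(3) by (simp add: s3_def)
    fix f assume "f \<in> set (fs @ gs)"
    then show "f holomorphic_on ball 0 s3"
      using 1(2) 2(2) sub by (auto intro: holomorphic_on_subset)
  next
    fix z :: complex assume "z \<in> ball 0 s3"
    then have "z \<in> ball 0 s" "z \<in> ball 0 s1" "z \<in> ball 0 s2"
      using sub by blast+
    then show "P z = linprod (map (\<lambda>f. f z) (fs @ gs))"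
      using assms(4)[of z] 1(3)[of z] 2(3)[of z] by simp
  qed
qed

text \<open>Taking the full power of the linear factor of \<open>c\<close> at the base point makes
  it coprime to the cofactor, and the second root \<open>d\<close> makes the cofactor nonconstant.
  Both lifted factors therefore have degree below \<open>n\<close>, and their roots at real
  parameters are roots of \<open>P\<close>.\<close>

lemma splits_near_0_if_distinct_roots:
  assumes P: "hyperbolic_family P n r"
    and IH: "\<And>m Q s. m < n \<Longrightarrow> hyperbolic_family Q m s \<Longrightarrow> splits_near_0 Q"
    and roots: "poly (P 0) c = 0" "poly (P 0) d = 0" "c \<noteq> d"
  shows "splits_near_0 P"
proof -
  note P' = hyperbolic_familyD[OF P]
  have P0: "degree (P 0) = n" "coeff (P 0) n = 1"
    using P'(1) P'(3)[of 0] P'(4)[of 0] by auto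
  then have nz: "P 0 \<noteq> 0"
    by auto
  define p where "p = Polynomial.order c (P 0)"
  define A where "A = [:- c, 1:] ^ p"
  obtain B where B: "P 0 = A * B" "\<not> [:- c, 1:] dvd B"
    using order_decomp[OF nz, of c] by (auto simp: A_def p_def)
  have Bc: "poly B c \<noteq> 0"
    using B(2) by (simp add: poly_eq_0_iff_dvd)
  have A: "degree A = p" "coeff A p = 1"
    by (simp_all add: A_def degree_linear_power coeff_linear_power)
  have nz': "A \<noteq> 0" "B \<noteq> 0"
    using nz B by auto
  define q where "q = degree B"
  have pq: "p + q = n"
    using P0 B(1) nz' A by (simp add: degree_mult_eq q_def)
  have "lead_coeff (P 0) = lead_coeff A * lead_coeff B"
    unfolding B(1) by (rule lead_coeff_mult)
  then have lB: "coeff B q = 1"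
    using P0 A by (simp add: q_def)
  have p: "p > 0"
    using roots(1) nz by (simp add: p_def order_root)
  have "poly A d \<noteq> 0"
    using roots(3) by (simp add: A_def)
  then have "poly B d = 0"
    using roots(2) B(1) by simp
  then have q: "q > 0"
    unfolding q_def using nz'(2) by (metis gr0I degree_eq_zeroE pCons_eq_0_iff poly_const_conv)
  obtain a b where bez: "a * A + b * B = 1"
    using bezout_linear_power[OF Bc, of p] by (auto simp: A_def)
  have monic: "degree (P z) = p + q \<and> coeff (P z) (p + q) = 1" if "z \<in> ball 0 r" for z
    using P'(3)[OF that] P'(4)[OF that] pq by simp
  show ?thesis
  proof (rule holomorphic_factorization[OF P'(1) P'(2) monic B(1) A q_def[symmetric] lB bez p q])
    fix s Q R
    assume s: "0 < s" "s \<le> r" and hol: "holo_poly Q (ball 0 s)" "holo_poly R (ball 0 s)"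
      and eq: "\<And>z. z \<in> ball 0 s \<Longrightarrow> P z = Q z * R z"
      and Q: "\<And>z. z \<in> ball 0 s \<Longrightarrow> degree (Q z) = p \<and> coeff (Q z) p = 1"
      and R: "\<And>z. z \<in> ball 0 s \<Longrightarrow> degree (R z) = q \<and> coeff (R z) q = 1"
    have real: "x \<in> \<real>" if "\<bar>t\<bar> < s" "poly (Q (of_real t)) x = 0 \<or> poly (R (of_real t)) x = 0" for t :: real and x
      using that s eq[of "of_real t"] P'(5)[of t x] by auto
    have "hyperbolic_family Q p s" "hyperbolic_family R q s"
      unfolding hyperbolic_family_def using s hol Q R real by auto
    then have "splits_near_0 Q" "splits_near_0 R"
      using IH[of p Q s] IH[of q R s] p q pq by auto
    then show ?thesis
      using s(1) eq by (rule splits_near_0_mult)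
  qed
qed

text \<open>Squares of real numbers cannot cancel, so their sum controls each of them; for 1 and the
  imaginary unit it would be 0.\<close>

lemma sum_list_squares_real:
  fixes as :: "complex list"
  assumes "\<And>a. a \<in> set as \<Longrightarrow> a \<in> \<real>"
  shows "\<exists>y. (\<Sum>a\<leftarrow>as. a\<^sup>2) = of_real y \<and> (\<forall>a\<in>set as. (norm a)\<^sup>2 \<le> y) \<and> 0 \<le> y"
  using assms
proof (induction as)
  case Nil
  show ?case by (rule exI[of _ 0]) simp
next
  case (Cons a as)
  obtain y where y: "(\<Sum>a\<leftarrow>as. a\<^sup>2) = of_real y" "\<forall>a\<in>set as. (norm a)\<^sup>2 \<le> y" "0 \<le> y"
    using Cons by auto
  obtain x where x: "a = of_real x"
    using Cons.prems[of a] by (auto elim: Reals_cases)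
  have "(norm b)\<^sup>2 \<le> x\<^sup>2 + y" if "b \<in> set as" for b
    using y(2) that by (meson add_increasing zero_le_power2)
  then show ?case
    using x y by (intro exI[of _ "x\<^sup>2 + y"]) auto
qed

text \<open>If the roots have sum zero, their squares sum to minus twice the third coefficient
  \<open>a(t)\<close>. So \<open>a\<close> is nonpositive on the reals and vanishes at \<open>0\<close> to an even order
  \<open>2e\<close>; all roots are \<open>O(\<bar>t\<bar>\<^sup>e)\<close>, and rescaling them by \<open>t\<^sup>e\<close> gives a family that
  does have distinct roots at \<open>0\<close>.\<close>

lemma splits_near_0_if_trace_zero:
  assumes P: "hyperbolic_family P n r" and n: "n \<ge> 2"
    and IH: "\<And>m Q s. m < n \<Longrightarrow> hyperbolic_family Q m s \<Longrightarrow> splits_near_0 Q"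
    and trace: "\<And>z. z \<in> ball 0 r \<Longrightarrow> coeff (P z) (n - 1) = 0"
  shows "splits_near_0 P"
proof -
  note P' = hyperbolic_familyD[OF P]
  define f where "f z = coeff (P z) (n - 2)" for z
  have hf: "f holomorphic_on ball 0 r"
    unfolding f_def using P'(2) by (rule holo_polyD)
  have sq: "\<exists>as y. P (of_real t) = linprod as \<and> length as = n \<and> (\<forall>a\<in>set as. a \<in> \<real> \<and> (norm a)\<^sup>2 \<le> y) \<and>
      0 \<le> y \<and> of_real y = - 2 * f (of_real t)" if t: "\<bar>t\<bar> < r" for t :: real
  proof -
    obtain as where as: "P (of_real t) = linprod as" "length as = n" "\<And>a. a \<in> set as \<Longrightarrow> a \<in> \<real>"
      using hyperbolic_family_roots[OF P t] by blast
    obtain y where y: "(\<Sum>a\<leftarrow>as. a\<^sup>2) = of_real y" "\<forall>a\<in>set as. (norm a)\<^sup>2 \<le> y" "0 \<le> y"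
      using sum_list_squares_real[of as] as(3) by auto
    have "as \<noteq> []"
      using as(2) n by auto
    then have "sum_list as = 0"
      using coeff_linprod_penultimate[of as] trace[of "of_real t"] as(1,2) t by simp
    then have "2 * f (of_real t) = - of_real y"
      using coeff_linprod_antepenultimate[of as] as n y(1) by (simp add: f_def)
    then show ?thesis
      using as y by (intro exI[of _ as] exI[of _ y]) auto
  qed
  show ?thesis
  proof (cases "\<forall>z\<in>ball 0 r. f z = 0")
    \<comment> \<open>Here the squares of the roots sum to 0 at every real parameter, so
      \<open>P\<close> is x^n there and, by continuation, on the whole ball.\<close>
    case True
    have real: "P (of_real t) = linprod (replicate n 0)" if t: "\<bar>t\<bar> < r" for t :: real
    proof -
      obtain as y where as: "P (of_real t) = linprod as" "length as = n"
        "\<And>a. a \<in> set as \<Longrightarrow> (norm a)\<^sup>2 \<le> y" "of_real y = - 2 * f (of_real t)"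
        using sq[OF t] by blast
      have "y = 0"
        using as(4) True t by simp
      then have "a = 0" if "a \<in> set as" for a
        using as(3)[OF that] by simp
      then have "as = replicate n 0"
        using as(2) by (simp add: replicate_eqI)
      then show ?thesis
        using as(1) by simp
    qed
    have "P z = linprod (replicate n 0)" if z: "z \<in> ball 0 r" for z
    proof (rule poly_eqI)
      fix j
      show "coeff (P z) j = coeff (linprod (replicate n 0)) j"
        by (rule holomorphic_eq_if_eq_on_reals[OF P'(1) holo_polyD[OF P'(2)] _ _ z])
          (auto simp: real intro: holomorphic_intros)
    qed
    then show ?thesis
      unfolding splits_near_0_def using P'(1)
      by (intro exI[of _ r] conjI exI[of _ "replicate n (\<lambda>z. 0)"]) (auto simp: map_replicate)
  next
    case False
    then obtain z0 where z0: "z0 \<in> ball 0 r" "f z0 \<noteq> 0"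
      by blast
    have "\<exists>m g s0. 0 < s0 \<and> s0 \<le> r \<and> g holomorphic_on ball 0 s0 \<and> g 0 \<noteq> 0 \<and>
        (\<forall>z\<in>ball 0 s0. f z = z ^ m * g z)"
      by (rule holomorphic_factor_power[OF P'(1) hf z0]) fast
    then obtain m g s0 where s0: "0 < s0" "s0 \<le> r" and g: "g holomorphic_on ball 0 s0" "g 0 \<noteq> 0"
      and fg: "\<And>z. z \<in> ball 0 s0 \<Longrightarrow> f z = z ^ m * g z"
      by blast
    have "even m"
    proof (rule even_vanishing_order_if_nonpos[OF s0(1) g])
      fix t :: real assume t: "t \<noteq> 0" "\<bar>t\<bar> < s0"
      then obtain y where "0 \<le> y" "of_real y = - 2 * f (of_real t)"
        using sq[of t] s0 by auto
      then show "\<exists>y\<le>0. of_real t ^ m * g (of_real t) = of_real y"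
        using fg[of "of_real t"] t by (intro exI[of _ "- y / 2"]) auto
    qed
    \<comment> \<open>The squares of the roots are O(|t|^m); evenness of \<open>m\<close> makes the
      rescaling exponent an integer, which excludes fractional powers of \<open>t\<close>.\<close>
    then obtain e where e: "m = 2 * e"
      by (auto elim: evenE)
    have "isCont g 0"
      using holomorphic_on_imp_continuous_on[OF g(1)] s0
      by (simp add: continuous_on_eq_continuous_at)
    then have "\<exists>d>0. \<forall>z. dist z 0 < d \<longrightarrow> dist (g z) (g 0) < 1"
      unfolding continuous_at_eps_delta by simp
    then obtain d where d: "d > 0" "\<And>z. dist z 0 < d \<Longrightarrow> dist (g z) (g 0) < 1"
      by blast
    define s where "s = min s0 d"
    define K where "K = norm (g 0) + 1"
    have s: "s > 0" "s \<le> s0" "s \<le> r"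
      using s0 d by (auto simp: s_def)
    have gK: "norm (g z) \<le> K" if "z \<in> ball 0 s" for z
    proof -
      have "dist (g z) (g 0) < 1"
        using that by (intro d) (simp add: s_def)
      then show ?thesis
        using norm_triangle_ineq2[of "g z" "g 0"] by (simp add: K_def dist_norm)
    qed
    \<comment> \<open>Near 0 the squares of the rescaled roots are at most \<open>2 * K\<close>.
      This \<open>C\<close> satisfies \<open>2 * K \<le> C\<^sup>2\<close> and so bounds the roots
      without a square root.\<close>
    define C where "C = 1 + 2 * K"
    have K: "K \<ge> 0" "C \<ge> 0" "2 * K \<le> C\<^sup>2"
      by (auto simp: C_def K_def power2_eq_square algebra_simps)
    have scaled: "\<exists>ys. length ys = n \<and> (\<forall>y\<in>set ys. y \<in> \<real> \<and> norm y \<le> C) \<and>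
        P (of_real t) = linprod (map (\<lambda>y. of_real t ^ e * y) ys)" if t: "t \<noteq> 0" "\<bar>t\<bar> < s" for t :: real
    proof -
      have tr: "\<bar>t\<bar> < r"
        using t s by linarith
      obtain as y where as: "P (of_real t) = linprod as" "length as = n"
        "\<And>a. a \<in> set as \<Longrightarrow> a \<in> \<real>" "\<And>a. a \<in> set as \<Longrightarrow> (norm a)\<^sup>2 \<le> y"
        "0 \<le> y" "of_real y = - 2 * f (of_real t)"
        using sq[OF tr] by blast
      have pow: "(\<bar>t\<bar> ^ e)\<^sup>2 = \<bar>t\<bar> ^ (2 * e)"
        by (simp only: power_mult[symmetric] mult.commute[of e 2])
      have "y = norm (complex_of_real y)"
        using as(5) by simp
      also have "\<dots> = 2 * (\<bar>t\<bar> ^ e)\<^sup>2 * norm (g (of_real t))"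
        unfolding as(6) using fg[of "of_real t"] t s pow
        by (simp add: norm_mult norm_power e)
      also have "\<dots> \<le> 2 * (\<bar>t\<bar> ^ e)\<^sup>2 * K"
        using gK[of "of_real t"] t by (intro mult_left_mono) auto
      also have "\<dots> = (\<bar>t\<bar> ^ e)\<^sup>2 * (2 * K)"
        by simp
      also have "\<dots> \<le> (\<bar>t\<bar> ^ e)\<^sup>2 * C\<^sup>2"
        by (intro mult_left_mono K) auto
      finally have y: "y \<le> (\<bar>t\<bar> ^ e * C)\<^sup>2"
        by (simp add: power_mult_distrib)
      define ys where "ys = map (\<lambda>a. a / of_real t ^ e) as"
      have "a / of_real t ^ e \<in> \<real> \<and> norm (a / of_real t ^ e) \<le> C" if "a \<in> set as" for a
      proof -
        have "(norm a)\<^sup>2 \<le> (\<bar>t\<bar> ^ e * C)\<^sup>2"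
          using as(4)[OF that] y by linarith
        then have "norm a \<le> \<bar>t\<bar> ^ e * C"
          by (rule power2_le_imp_le) (use K in simp)
        then show ?thesis
          using as(3)[OF that] t by (auto simp: norm_divide norm_power field_simps)
      qed
      then have "\<forall>y\<in>set ys. y \<in> \<real> \<and> norm y \<le> C"
        by (auto simp: ys_def)
      moreover have "map (\<lambda>y. of_real t ^ e * y) ys = as"
        using t by (simp add: ys_def o_def)
      ultimately show ?thesis
        using as(1,2) by (intro exI[of _ ys]) (simp add: ys_def)
    qed
    have bound: "norm (coeff (P (of_real t)) j) \<le> (1 + C) ^ n * \<bar>t\<bar> ^ (e * (n - j))"
      if t: "t \<noteq> 0" "\<bar>t\<bar> < s" and j: "j \<le> n" for t :: real and j
    proof -
      obtain ys where ys: "length ys = n" "\<forall>y\<in>set ys. y \<in> \<real> \<and> norm y \<le> C"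
        "P (of_real t) = linprod (map (\<lambda>y. of_real t ^ e * y) ys)"
        using scaled[OF t] by blast
      have "norm (coeff (linprod ys) j) \<le> (1 + C) ^ n"
        using norm_coeff_le_pnorm[of "linprod ys" j] pnorm_linprod[of ys C] ys(1,2) K by auto
      then have "(\<bar>t\<bar> ^ e) ^ (n - j) * norm (coeff (linprod ys) j) \<le> (\<bar>t\<bar> ^ e) ^ (n - j) * (1 + C) ^ n"
        by (intro mult_left_mono) auto
      moreover have "norm (coeff (P (of_real t)) j) = (\<bar>t\<bar> ^ e) ^ (n - j) * norm (coeff (linprod ys) j)"
        unfolding ys(3) using coeff_linprod_scale[of j ys "of_real t ^ e"] ys(1) j
        by (simp add: norm_mult norm_power)
      ultimately show ?thesis
        by (simp add: power_mult mult.commute)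
    qed
    have "\<exists>b. b holomorphic_on ball 0 s \<and> (\<forall>z\<in>ball 0 s. coeff (P z) j = z ^ (e * (n - j)) * b z)"
      if j: "j \<le> n" for j
    proof -
      have "(\<lambda>z. coeff (P z) j) holomorphic_on ball 0 s"
        by (rule holomorphic_on_subset[OF holo_polyD[OF P'(2)]]) (use s in auto)
      then show ?thesis
        using bound[OF _ _ j] by (rule holomorphic_divide_power[OF s(1)])
    qed
    then have "\<forall>j\<in>{..n}. \<exists>b. b holomorphic_on ball 0 s \<and> (\<forall>z\<in>ball 0 s. coeff (P z) j = z ^ (e * (n - j)) * b z)"
      by simp
    from bchoice[OF this] obtain b where "\<forall>j\<in>{..n}. b j holomorphic_on ball 0 s \<and>
        (\<forall>z\<in>ball 0 s. coeff (P z) j = z ^ (e * (n - j)) * b j z)" ..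
    then have b: "\<And>j. j \<le> n \<Longrightarrow> b j holomorphic_on ball 0 s"
      "\<And>j z. j \<le> n \<Longrightarrow> z \<in> ball 0 s \<Longrightarrow> coeff (P z) j = z ^ (e * (n - j)) * b j z"
      by simp_all
    \<comment> \<open>For \<open>z \<noteq> 0\<close> the roots of \<open>Q z\<close> are those of
      \<open>P z\<close> divided by z^e. At 0 this description fails and only the extended
      coefficients \<open>b j\<close> are available.\<close>
    define Q where "Q z = (\<Sum>j\<le>n. monom (b j z) j)" for z
    have cQ: "coeff (Q z) j = (if j \<le> n then b j z else 0)" for z j
      by (simp add: Q_def coeff_sum)
    have bn: "b n z = 1" if "z \<in> ball 0 s" for z
      using b(2)[of n z] that P'(4)[of z] s by auto
    have degQ: "degree (Q z) = n" if "z \<in> ball 0 s" for z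
    proof (rule antisym)
      show "degree (Q z) \<le> n" by (rule degree_le) (simp add: cQ)
      show "n \<le> degree (Q z)" by (rule le_degree) (simp add: cQ bn[OF that])
    qed
    have holQ: "holo_poly Q (ball 0 s)"
      unfolding holo_poly_def cQ
    proof
      fix j show "(\<lambda>z. if j \<le> n then b j z else 0) holomorphic_on ball 0 s"
        using b(1)[of j] by (cases "j \<le> n") auto
    qed
    have lower: "\<bar>Im w\<bar> ^ n \<le> norm (poly (Q (of_real t)) w)" if t: "t \<noteq> 0" "\<bar>t\<bar> < s" for t :: real and w
    proof -
      obtain ys where ys: "length ys = n" "\<forall>y\<in>set ys. y \<in> \<real> \<and> norm y \<le> C"
        "P (of_real t) = linprod (map (\<lambda>y. of_real t ^ e * y) ys)"
        using scaled[OF t] by blast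
      have "Q (of_real t) = linprod ys"
      proof (rule poly_eqI)
        fix j
        show "coeff (Q (of_real t)) j = coeff (linprod ys) j"
        proof (cases "j \<le> n")
          case True
          have "(of_real t ^ e) ^ (n - j) * coeff (linprod ys) j = (of_real t ^ e) ^ (n - j) * b j (of_real t)"
            using b(2)[OF True, of "of_real t"] t coeff_linprod_scale[of j ys "of_real t ^ e"] True ys(1)
            unfolding ys(3) by (simp add: power_mult)
          then show ?thesis
            using t True by (simp add: cQ)
        qed (use ys(1) in \<open>simp add: cQ coeff_eq_0\<close>)
      qed
      then show ?thesis
        using poly_linprod_lower_bound[of ys w] ys by simp
    qed
    have "x \<in> \<real>" if t: "\<bar>t\<bar> < s" and x: "poly (Q (of_real t)) x = 0" for t :: real and x
    proof -
      have "\<bar>Im x\<bar> ^ n \<le> norm (poly (Q (of_real t)) x)"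
      proof (cases "t = 0")
        \<comment> \<open>The factorization behind \<open>lower\<close> is available only for
          \<open>t \<noteq> 0\<close>; continuity carries the inequality to 0.\<close>
        case True
        have "continuous_on (ball 0 s) (\<lambda>z. norm (\<Sum>j\<le>n. b j z * x ^ j))"
          using b(1) by (intro continuous_intros holomorphic_on_imp_continuous_on) auto
        moreover have "poly (Q z) x = (\<Sum>j\<le>n. b j z * x ^ j)" for z
          by (simp add: Q_def poly_sum poly_monom)
        ultimately have "isCont (\<lambda>z. norm (poly (Q z) x)) 0"
          using s(1) by (simp add: continuous_on_eq_continuous_at)
        then have "isCont (\<lambda>t::real. norm (poly (Q (of_real t)) x)) 0"
          using isCont_o2[of 0 complex_of_real "\<lambda>z. norm (poly (Q z) x)"] by simp
        then have "((\<lambda>t::real. norm (poly (Q (of_real t)) x)) \<longlongrightarrow> norm (poly (Q 0) x)) (at 0)"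
          by (simp add: isCont_def)
        moreover have "eventually (\<lambda>t::real. t \<noteq> 0 \<and> \<bar>t\<bar> < s) (at 0)"
          unfolding eventually_at using s(1) by (intro exI[of _ s]) (auto simp: dist_norm)
        then have "eventually (\<lambda>t::real. \<bar>Im x\<bar> ^ n \<le> norm (poly (Q (of_real t)) x)) (at 0)"
          by (rule eventually_mono) (use lower in blast)
        ultimately have "\<bar>Im x\<bar> ^ n \<le> norm (poly (Q 0) x)"
          by (rule tendsto_lowerbound) simp
        then show ?thesis
          using True by simp
      qed (use lower t in blast)
      then have "\<bar>Im x\<bar> ^ n = 0"
        using x by (intro antisym) auto
      then show ?thesis
        by (simp add: complex_is_Real_iff)
    qed
    then have Q: "hyperbolic_family Q n s"
      unfolding hyperbolic_family_def using s(1) holQ degQ bn by (auto simp: cQ)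
    have "b (n - 1) 0 = 0"
    proof (rule holomorphic_cancel_power[OF s(1), where f="b (n - 1)" and g="\<lambda>_. 0" and d=e and z=0])
      fix z :: complex assume "z \<in> ball 0 s"
      then show "z ^ e * b (n - 1) z = z ^ e * 0"
        using b(2)[of "n - 1" z] trace[of z] n s by simp
    qed (use b(1)[of "n - 1"] s(1) in auto)
    \<comment> \<open>This coefficient was divided by z^(2 e) = z^m, its exact order, so a nonzero
      value remains at 0. Equal roots with sum zero would all be 0 and make it vanish: hence two
      roots of \<open>Q 0\<close> differ.\<close>
    moreover have "b (n - 2) 0 = g 0"
    proof (rule holomorphic_cancel_power[OF s(1), where f="b (n - 2)" and g=g and d=m and z=0])
      fix z :: complex assume z: "z \<in> ball 0 s"
      have "f z = z ^ m * b (n - 2) z"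
        using b(2)[of "n - 2" z] n z by (simp add: f_def e mult.commute)
      then show "z ^ m * b (n - 2) z = z ^ m * g z"
        using fg[of z] z s by simp
    qed (use b(1)[of "n - 2"] s(1) holomorphic_on_subset[OF g(1) subset_ball[OF s(2)]] in auto)
    ultimately have Q0: "coeff (Q 0) (n - 1) = 0" "coeff (Q 0) (n - 2) \<noteq> 0"
      using g(2) by (auto simp: cQ)
    have "degree (Q 0) = n" "coeff (Q 0) n = 1"
      using degQ[of 0] s(1) bn[of 0] by (auto simp: cQ)
    then obtain as where as: "Q 0 = linprod as" "length as = n"
      by (rule monic_eq_linprod)
    have "as \<noteq> []"
      using as(2) n by auto
    then have sum0: "sum_list as = 0"
      using Q0(1) coeff_linprod_penultimate[of as] as by simp
    have "(\<Sum>a\<leftarrow>as. a\<^sup>2) \<noteq> 0"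
      using Q0(2) coeff_linprod_antepenultimate[of as] as n sum0 by auto
    have "\<exists>c\<in>set as. \<exists>d\<in>set as. c \<noteq> d"
    proof (rule ccontr)
      assume no: "\<not> ?thesis"
      have "x = hd as" if "x \<in> set as" for x
        using no that hd_in_set[OF \<open>as \<noteq> []\<close>] by blast
      then have "as = replicate n (hd as)"
        using as(2) by (intro replicate_eqI) auto
      then have "sum_list as = of_nat n * hd as"
        by (metis sum_list_replicate)
      then have "hd as = 0"
        using sum0 n by simp
      then have "as = replicate n 0"
        using \<open>as = replicate n (hd as)\<close> by simp
      then have "(\<Sum>a\<leftarrow>as. a\<^sup>2) = 0"
        by (simp add: sum_list_replicate)
      then show False
        using \<open>(\<Sum>a\<leftarrow>as. a\<^sup>2) \<noteq> 0\<close> by simp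
    qed
    then obtain c d where cd: "c \<in> set as" "d \<in> set as" "c \<noteq> d"
      by blast
    have "splits_near_0 Q"
    proof (rule splits_near_0_if_distinct_roots[OF Q])
      show "splits_near_0 Q'" if "m < n" "hyperbolic_family Q' m s'" for m Q' s'
        using that by (rule IH)
      show "poly (Q 0) c = 0" "poly (Q 0) d = 0" "c \<noteq> d"
        using cd as(1) by (auto simp: poly_linprod_eq_0_iff)
    qed
    then obtain s1 fs where fs: "s1 > 0" "\<And>f. f \<in> set fs \<Longrightarrow> f holomorphic_on ball 0 s1"
      "\<And>z. z \<in> ball 0 s1 \<Longrightarrow> Q z = linprod (map (\<lambda>f. f z) fs)"
      unfolding splits_near_0_def by blast
    have len: "length fs = n"
      using fs(3)[of 0] fs(1) as by (metis centre_in_ball degree_linprod length_map)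
    define s2 where "s2 = min s s1"
    have sub: "ball 0 s2 \<subseteq> (ball 0 s1 :: complex set)"
      by (auto simp: s2_def)
    show ?thesis
      unfolding splits_near_0_def
    proof (intro exI[of _ s2] conjI exI[of _ "map (\<lambda>f z. z ^ e * f z) fs"] ballI)
      show "s2 > 0" using s fs by (simp add: s2_def)
      fix h assume "h \<in> set (map (\<lambda>f z. z ^ e * f z) fs)"
      then obtain f' where "f' \<in> set fs" "h = (\<lambda>z. z ^ e * f' z)"
        by auto
      then show "h holomorphic_on ball 0 s2"
        using holomorphic_on_subset[OF fs(2)[of f'] sub]
        by (auto intro!: holomorphic_intros)
    next
      fix z :: complex assume "z \<in> ball 0 s2"
      then have z: "z \<in> ball 0 s" "z \<in> ball 0 s1"
        by (auto simp: s2_def)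
      define vs where "vs = map (\<lambda>f. f z) fs"
      have "P z = linprod (map (\<lambda>v. z ^ e * v) vs)"
      proof (rule poly_eqI)
        fix j
        show "coeff (P z) j = coeff (linprod (map (\<lambda>v. z ^ e * v) vs)) j"
        proof (cases "j \<le> n")
          case True
          have "coeff (linprod (map (\<lambda>v. z ^ e * v) vs)) j = (z ^ e) ^ (n - j) * coeff (Q z) j"
            unfolding fs(3)[OF z(2)] using coeff_linprod_scale[of j vs "z ^ e"] True len
            by (simp add: vs_def)
          then show ?thesis
            using b(2)[OF True z(1)] True by (simp add: cQ power_mult)
        next
          case False
          then show ?thesis
            using P'(3)[of z] z(1) s len by (simp add: coeff_eq_0 vs_def)
        qed
      qed
      then show "P z = linprod (map (\<lambda>f. f z) (map (\<lambda>f z. z ^ e * f z) fs))"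
        by (simp add: vs_def o_def)
    qed
  qed
qed

text \<open>A fixed summation range shows that the coefficients of the composition depend
  holomorphically on those of \<open>p\<close> and \<open>q\<close>.\<close>

lemma pcompose_eq_sum:
  fixes p q :: "complex poly"
  assumes "degree p \<le> n"
  shows "pcompose p q = (\<Sum>j\<le>n. Polynomial.smult (coeff p j) (q ^ j))"
proof -
  have "poly (pcompose p q) x = poly (\<Sum>j\<le>n. Polynomial.smult (coeff p j) (q ^ j)) x" for x
  proof -
    have "poly (pcompose p q) x = (\<Sum>j\<le>n. coeff p j * poly q x ^ j)"
      unfolding poly_pcompose poly_altdef[of p]
      by (rule sum.mono_neutral_left) (use assms in \<open>auto simp: coeff_eq_0\<close>)
    then show ?thesis
      by (simp add: poly_sum)
  qed
  then show ?thesis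
    by (simp add: poly_eq_poly_eq_iff[symmetric] fun_eq_iff)
qed

text \<open>Induction on the degree. Centring and rescaling keep the degree; the descent comes from
  the factorization that the resulting distinct roots permit.\<close>

lemma hyperbolic_family_splits:
  "hyperbolic_family P n r \<Longrightarrow> splits_near_0 P"
proof (induction n arbitrary: P r rule: less_induct)
  case (less n)
  note P = hyperbolic_familyD[OF less.prems]
  have roots: "\<exists>as. P z = linprod as \<and> length as = n" if "z \<in> ball 0 r" for z
    using P(3,4)[OF that] by (metis monic_eq_linprod)
  show ?case
  proof (cases "n = 0")
    case True
    then have "P z = linprod []" if "z \<in> ball 0 r" for z
      using roots[OF that] by auto
    then show ?thesis
      unfolding splits_near_0_def using P(1) by (intro exI[of _ r] conjI exI[of _ "[]"]) auto
  next
    case False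
    \<comment> \<open>By Vieta \<open>a z\<close> is minus the mean of the roots, so the roots of
      \<open>Q z\<close> are those of \<open>P z\<close> minus their mean.\<close>
    define a where "a z = coeff (P z) (n - 1) / of_nat n" for z
    have a: "a z = - sum_list as / of_nat n" if "P z = linprod as" "length as = n" for as z
      using coeff_linprod_penultimate[of as] that False by (auto simp: a_def)
    have ha: "a holomorphic_on ball 0 r"
      unfolding a_def using holo_polyD[OF P(2)] by (intro holomorphic_intros) (use False in auto)
    define Q where "Q z = pcompose (P z) [:- a z, 1:]" for z
    have Qlin: "\<exists>bs. Q z = linprod bs \<and> length bs = n \<and> sum_list bs = 0" if z: "z \<in> ball 0 r" for z
    proof -
      obtain as where as: "P z = linprod as" "length as = n"
        using roots[OF z] by blast
      have "Q z = linprod (map (\<lambda>x. x - - a z) as)"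
        unfolding Q_def as(1) by (rule pcompose_linprod)
      moreover have "sum_list (map (\<lambda>x. x - - a z) as) = sum_list as + of_nat n * a z"
        by (simp add: sum_list_addf sum_list_triv as(2))
      then have "sum_list (map (\<lambda>x. x - - a z) as) = 0"
        using a[OF as] False by simp
      ultimately show ?thesis
        using as(2) by (intro exI[of _ "map (\<lambda>x. x - - a z) as"]) simp
    qed
    have "hyperbolic_family Q n r"
      unfolding hyperbolic_family_def
    proof (intro conjI ballI allI impI)
      show "r > 0" by fact
      have "holo_poly (\<lambda>z. \<Sum>j\<le>n. Polynomial.smult (coeff (P z) j) ([:- a z, 1:] ^ j)) (ball 0 r)"
        by (intro holo_poly_sum holo_poly_smult holo_poly_power holo_poly_pCons holo_polyD[OF P(2)]
            holomorphic_intros ha holo_poly_const)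
      moreover have "Q z = (\<Sum>j\<le>n. Polynomial.smult (coeff (P z) j) ([:- a z, 1:] ^ j))" if "z \<in> ball 0 r" for z
        unfolding Q_def using P(3)[OF that] by (intro pcompose_eq_sum) simp
      ultimately show "holo_poly Q (ball 0 r)"
        unfolding holo_poly_def by (metis (no_types, lifting) holomorphic_cong)
    next
      fix z :: complex assume "z \<in> ball 0 r"
      then obtain bs where "Q z = linprod bs" "length bs = n"
        using Qlin by blast
      then show "degree (Q z) = n" "coeff (Q z) n = 1"
        by auto
    next
      fix t :: real and x assume t: "\<bar>t\<bar> < r" and x: "poly (Q (of_real t)) x = 0"
      obtain as where as: "P (of_real t) = linprod as" "length as = n" "\<And>a. a \<in> set as \<Longrightarrow> a \<in> \<real>"
        using hyperbolic_family_roots[OF less.prems t] by blast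
      have "sum_list as \<in> \<real>"
        using as(3) by (induction as) auto
      then have "a (of_real t) \<in> \<real>"
        unfolding a[OF as(1,2)] by (intro Reals_divide) auto
      moreover have "x - a (of_real t) \<in> \<real>"
        using x P(5)[OF t, of "x - a (of_real t)"] by (simp add: Q_def poly_pcompose)
      ultimately show "x \<in> \<real>"
        using Reals_add by fastforce
    qed
    moreover have "coeff (Q z) (n - 1) = 0" if "z \<in> ball 0 r" for z
      using Qlin[OF that] coeff_linprod_penultimate False by fastforce
    ultimately have "splits_near_0 Q"
    proof (cases "n \<ge> 2")
      case True
      assume "hyperbolic_family Q n r" "\<And>z. z \<in> ball 0 r \<Longrightarrow> coeff (Q z) (n - 1) = 0"
      then show ?thesis
        using splits_near_0_if_trace_zero[of Q n r] True less.IH by blast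
    next
      \<comment> \<open>In degree one there is no third coefficient, but the centred polynomial is x
        itself.\<close>
      assume "\<not> n \<ge> 2"
      with False have "n = 1" by simp
      then have "Q z = linprod (map (\<lambda>f. f z) [\<lambda>z. 0])" if "z \<in> ball 0 r" for z
        using Qlin[OF that] by (auto simp: length_Suc_conv)
      then show ?thesis
        unfolding splits_near_0_def using P(1)
        by (intro exI[of _ r] conjI exI[of _ "[\<lambda>z. 0]"]) auto
    qed
    then obtain s fs where fs: "s > 0" "\<And>f. f \<in> set fs \<Longrightarrow> f holomorphic_on ball 0 s"
      "\<And>z. z \<in> ball 0 s \<Longrightarrow> Q z = linprod (map (\<lambda>f. f z) fs)"
      unfolding splits_near_0_def by blast
    define s2 where "s2 = min r s"
    have sub: "ball 0 s2 \<subseteq> (ball 0 s :: complex set)" "ball 0 s2 \<subseteq> (ball 0 r :: complex set)"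
      by (auto simp: s2_def)
    show ?thesis
      unfolding splits_near_0_def
    proof (intro exI[of _ s2] conjI exI[of _ "map (\<lambda>f z. f z - a z) fs"] ballI)
      show "s2 > 0" using P(1) fs(1) by (simp add: s2_def)
      fix h assume "h \<in> set (map (\<lambda>f z. f z - a z) fs)"
      then obtain f where "f \<in> set fs" "h = (\<lambda>z. f z - a z)"
        by auto
      then show "h holomorphic_on ball 0 s2"
        using holomorphic_on_subset[OF fs(2)[of f] sub(1)] holomorphic_on_subset[OF ha sub(2)]
        by (auto intro!: holomorphic_intros)
    next
      fix z :: complex assume "z \<in> ball 0 s2"
      then have z: "z \<in> ball 0 s"
        by (auto simp: s2_def)
      have "P z = pcompose (P z) (pcompose [:- a z, 1:] [:a z, 1:])"
        by (simp add: pcompose_pCons)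
      also have "\<dots> = pcompose (Q z) [:a z, 1:]"
        unfolding Q_def by (rule pcompose_assoc)
      also have "\<dots> = linprod (map (\<lambda>f. f z) (map (\<lambda>f z. f z - a z) fs))"
        unfolding fs(3)[OF z] pcompose_linprod by (simp add: o_def)
      finally show "P z = linprod (map (\<lambda>f. f z) (map (\<lambda>f z. f z - a z) fs))" .
    qed
  qed
qed

section \<open>Global eigenvalue branches\<close>

text \<open>A holomorphic extension replaces the power series, so that the complex identity theorem
  applies at once. It extends the translate of \<open>f\<close> by \<open>t0\<close> and thus lives
  on a ball about 0, like the functions in \<open>splits_near_0\<close>.\<close>

definition real_analytic_at :: "(real \<Rightarrow> real) \<Rightarrow> real \<Rightarrow> bool" where
  "real_analytic_at f t0 \<longleftrightarrow> (\<exists>r>0. \<exists>g. g holomorphic_on ball 0 r \<and>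
     (\<forall>t. \<bar>t\<bar> < r \<longrightarrow> g (complex_of_real t) = of_real (f (t0 + t))))"

lemma real_analytic_holomorphic_extension:
  fixes f :: "real \<Rightarrow> complex"
  assumes "real_analytic f"
  shows "\<exists>r>0. \<exists>g. g holomorphic_on ball 0 r \<and> (\<forall>t. \<bar>t\<bar> < r \<longrightarrow> g (complex_of_real t) = f (t0 + t))"
proof -
  obtain a r where r: "r > 0" and a: "\<And>t. \<bar>t - t0\<bar> < r \<Longrightarrow> (\<lambda>k. (t - t0) ^ k *\<^sub>R a k) sums f t"
    using spec[OF assms[unfolded real_analytic_def], of t0] by blast
  have sums: "(\<lambda>k. a k * of_real t ^ k) sums f (t0 + t)" if "\<bar>t\<bar> < r" for t
    using a[of "t0 + t"] that by (simp add: scaleR_conv_of_real mult.commute)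
  define g where "g z = (\<Sum>k. a k * z ^ k)" for z
  have "(\<lambda>k. a k * (z - 0) ^ k) sums g z" if z: "z \<in> ball 0 r" for z
  proof -
    \<comment> \<open>Abel's lemma: the series is known to converge only at real points, and the
      real point \<open>s\<close> beyond |z| yields convergence at \<open>z\<close>.\<close>
    obtain s where s: "norm z < s" "s < r"
      using z dense[of "norm z" r] by auto
    then have "s > 0"
      using norm_ge_zero[of z] by linarith
    have "summable (\<lambda>k. a k * of_real s ^ k)"
      using sums[of s] s \<open>s > 0\<close> by (auto intro: sums_summable)
    then have "summable (\<lambda>k. a k * z ^ k)"
      by (rule powser_inside) (use s \<open>s > 0\<close> in simp)
    then show ?thesis
      by (simp add: g_def summable_sums)
  qed
  then have "g holomorphic_on ball 0 r"
    by (rule power_series_holomorphic)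
  moreover have "g (of_real t) = f (t0 + t)" if "\<bar>t\<bar> < r" for t
    unfolding g_def using sums[OF that] by (rule sums_unique[symmetric])
  ultimately show ?thesis
    using r by blast
qed

lemma real_analytic_if_real_analytic_at:
  assumes "\<And>t. real_analytic_at f t"
  shows "real_analytic f"
  unfolding real_analytic_def
proof
  fix t0
  obtain r g where r: "r > 0" and g: "g holomorphic_on ball 0 r"
    and gf: "\<And>t. \<bar>t\<bar> < r \<Longrightarrow> g (complex_of_real t) = of_real (f (t0 + t))"
    using assms[of t0] unfolding real_analytic_at_def by blast
  have re: "Re (D * of_real y) = y * Re D" for D y
    by simp
  \<comment> \<open>Taking real parts of the whole expansion gives a real series without showing
    that the Taylor coefficients of \<open>g\<close> are real.\<close>
  define a where "a k = Re ((deriv ^^ k) g 0 / fact k)" for k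
  have "(\<lambda>k. (t - t0) ^ k *\<^sub>R a k) sums f t" if t: "\<bar>t - t0\<bar> < r" for t
  proof -
    have "(\<lambda>k. (deriv ^^ k) g 0 / fact k * (of_real (t - t0) - 0) ^ k) sums g (of_real (t - t0))"
      using t by (intro holomorphic_power_series[OF g]) (simp add: dist_norm del: of_real_diff)
    then have "(\<lambda>k. Re ((deriv ^^ k) g 0 / fact k * of_real (t - t0) ^ k)) sums Re (g (of_real (t - t0)))"
      unfolding diff_0_right by (rule sums_Re)
    moreover have "Re ((deriv ^^ k) g 0 / fact k * of_real (t - t0) ^ k) = (t - t0) ^ k *\<^sub>R a k" for k
      unfolding a_def of_real_power[symmetric] re real_scaleR_def ..
    moreover have "Re (g (of_real (t - t0))) = f t"
      using gf[OF t] by simp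
    ultimately show ?thesis
      by simp
  qed
  then show "\<exists>a r. r > 0 \<and> (\<forall>t. \<bar>t - t0\<bar> < r \<longrightarrow> (\<lambda>k. (t - t0) ^ k *\<^sub>R a k) sums f t)"
    using r by (intro exI[of _ a] exI[of _ r]) simp
qed

lemma real_analytic_at_if_real_analytic:
  assumes "real_analytic (f :: real \<Rightarrow> real)"
  shows "real_analytic_at f t0"
proof -
  have "real_analytic (\<lambda>t. complex_of_real (f t))"
    unfolding real_analytic_def
  proof
    fix t0
    obtain a r where r: "r > 0" and a: "\<And>t. \<bar>t - t0\<bar> < r \<Longrightarrow> (\<lambda>k. (t - t0) ^ k *\<^sub>R a k) sums f t"
      using spec[OF assms[unfolded real_analytic_def], of t0] by blast
    have "(\<lambda>k. (t - t0) ^ k *\<^sub>R complex_of_real (a k)) sums of_real (f t)" if "\<bar>t - t0\<bar> < r" for t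
    proof -
      have "(\<lambda>k. complex_of_real ((t - t0) ^ k *\<^sub>R a k)) sums of_real (f t)"
        unfolding sums_of_real_iff by (rule a[OF that])
      then show ?thesis
        by (simp add: scaleR_conv_of_real)
    qed
    then show "\<exists>a r. r > 0 \<and> (\<forall>t. \<bar>t - t0\<bar> < r \<longrightarrow> (\<lambda>k. (t - t0) ^ k *\<^sub>R a k) sums complex_of_real (f t))"
      using r by (intro exI[of _ "\<lambda>k. complex_of_real (a k)"] exI[of _ r]) simp
  qed
  from real_analytic_holomorphic_extension[OF this, of t0] show ?thesis
    unfolding real_analytic_at_def .
qed

lemma real_analytic_at_cong:
  assumes "real_analytic_at f t0" "e > 0" "\<And>t. \<bar>t - t0\<bar> < e \<Longrightarrow> h t = f t"
  shows "real_analytic_at h t0"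
proof -
  obtain r g where r: "r > 0" and g: "g holomorphic_on ball 0 r"
    and gf: "\<And>t. \<bar>t\<bar> < r \<Longrightarrow> g (complex_of_real t) = of_real (f (t0 + t))"
    using assms(1) unfolding real_analytic_at_def by blast
  have "g holomorphic_on ball 0 (min r e)"
    using g by (rule holomorphic_on_subset) auto
  moreover have "\<forall>t. \<bar>t\<bar> < min r e \<longrightarrow> g (complex_of_real t) = of_real (h (t0 + t))"
    using gf assms(3) by simp
  ultimately show ?thesis
    unfolding real_analytic_at_def using r assms(2) by (intro exI[of _ "min r e"]) auto
qed

lemma real_analytic_at_diff:
  assumes "real_analytic_at f t0" "real_analytic_at h t0"
  shows "real_analytic_at (\<lambda>t. f t - h t) t0"
proof -
  obtain r1 g1 where 1: "r1 > 0" "g1 holomorphic_on ball 0 r1"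
    "\<And>t. \<bar>t\<bar> < r1 \<Longrightarrow> g1 (complex_of_real t) = of_real (f (t0 + t))"
    using assms(1) unfolding real_analytic_at_def by blast
  obtain r2 g2 where 2: "r2 > 0" "g2 holomorphic_on ball 0 r2"
    "\<And>t. \<bar>t\<bar> < r2 \<Longrightarrow> g2 (complex_of_real t) = of_real (h (t0 + t))"
    using assms(2) unfolding real_analytic_at_def by blast
  define r where "r = min r1 r2"
  have "g1 holomorphic_on ball 0 r" "g2 holomorphic_on ball 0 r"
    by (rule holomorphic_on_subset[OF 1(2)] holomorphic_on_subset[OF 2(2)], force simp: r_def)+
  then have "(\<lambda>z. g1 z - g2 z) holomorphic_on ball 0 r"
    by (rule holomorphic_on_diff)
  then show ?thesis
    unfolding real_analytic_at_def using 1 2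
    by (intro exI[of _ r] conjI exI[of _ "\<lambda>z. g1 z - g2 z"]) (auto simp: r_def)
qed

lemma real_analytic_at_zero_dichotomy:
  assumes "real_analytic_at f c"
  shows "eventually (\<lambda>t. f t = 0) (nhds c) \<or> eventually (\<lambda>t. f t \<noteq> 0) (at c)"
proof (rule disjCI)
  assume ne: "\<not> eventually (\<lambda>t. f t \<noteq> 0) (at c)"
  obtain r g where r: "r > 0" and g: "g holomorphic_on ball 0 r"
    and gf: "\<And>t. \<bar>t\<bar> < r \<Longrightarrow> g (complex_of_real t) = of_real (f (c + t))"
    using assms unfolding real_analytic_at_def by blast
  define U where "U = complex_of_real ` {t. \<bar>t\<bar> < r \<and> f (c + t) = 0}"
  have "0 islimpt U"
    unfolding islimpt_approachable
  proof (intro allI impI)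
    fix e :: real assume e: "e > 0"
    obtain t where t: "t \<noteq> c" "dist t c < min r e" "f t = 0"
      using ne[unfolded eventually_at, simplified, rule_format, of "min e r"] e r by auto
    show "\<exists>x'\<in>U. x' \<noteq> 0 \<and> dist x' 0 < e"
    proof (intro bexI conjI)
      show "complex_of_real (t - c) \<in> U"
        unfolding U_def using t by (intro imageI) (auto simp: dist_norm)
      show "complex_of_real (t - c) \<noteq> 0" "dist (complex_of_real (t - c)) 0 < e"
        using t by (auto simp: dist_norm simp flip: of_real_diff)
    qed
  qed
  have zero: "g z = 0" if "z \<in> ball 0 r" for z
  proof (rule analytic_continuation[where f=g and U=U and \<xi>=0 and S="ball 0 r"])
    show "\<And>z. z \<in> U \<Longrightarrow> g z = 0"
      using gf by (auto simp: U_def)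
  qed (use g r that \<open>0 islimpt U\<close> in \<open>auto simp: U_def\<close>)
  have "f t = 0" if "\<bar>t - c\<bar> < r" for t
    using gf[OF that] zero[of "of_real (t - c)"] that by (simp del: of_real_diff)
  then show "eventually (\<lambda>t. f t = 0) (nhds c)"
    unfolding eventually_nhds_metric using r by (auto simp: dist_norm)
qed

text \<open>The points near which \<open>f\<close> vanishes and the points with a punctured
  neighbourhood free of zeros form two disjoint open sets. By the dichotomy they cover the interval,
  so connectedness leaves only the one containing \<open>c\<close>.\<close>

lemma real_analytic_identity:
  assumes an: "\<And>t. t \<in> {a<..<b} \<Longrightarrow> real_analytic_at f t" and c: "c \<in> {a<..<b}"
    and ne: "\<not> eventually (\<lambda>t. f t \<noteq> 0) (at c)" and t: "t \<in> {a<..<b}"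
  shows "f t = 0"
proof -
  define U where "U = {x. eventually (\<lambda>t. f t = 0) (nhds x)}"
  define V where "V = {x. eventually (\<lambda>t. f t \<noteq> 0) (at x)}"
  have "open U"
    unfolding open_subopen[of U]
  proof
    fix x assume "x \<in> U"
    then obtain W where "open W" "x \<in> W" "\<forall>y\<in>W. f y = 0"
      unfolding U_def eventually_nhds by blast
    then show "\<exists>T. open T \<and> x \<in> T \<and> T \<subseteq> U"
      unfolding U_def eventually_nhds by (intro exI[of _ W]) auto
  qed
  moreover have "open V"
    unfolding open_subopen[of V]
  proof
    fix x assume "x \<in> V"
    then obtain W where W: "open W" "x \<in> W" "\<And>y. y \<in> W \<Longrightarrow> y \<noteq> x \<Longrightarrow> f y \<noteq> 0"
      unfolding V_def eventually_at_topological by blast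
    have "y \<in> V" if "y \<in> W" for y
    proof (cases "y = x")
      case True
      then show ?thesis using \<open>x \<in> V\<close> by simp
    next
      case False
      have "open (W - {x})"
        using W(1) by (simp add: open_Diff)
      then show ?thesis
        unfolding V_def eventually_at_topological using False that W(3) by blast
    qed
    then show "\<exists>T. open T \<and> x \<in> T \<and> T \<subseteq> V"
      using W by blast
  qed
  moreover have "U \<inter> V = {}"
  proof (rule ccontr)
    assume "U \<inter> V \<noteq> {}"
    then obtain x where x: "eventually (\<lambda>t. f t = 0) (nhds x)" "eventually (\<lambda>t. f t \<noteq> 0) (at x)"
      unfolding U_def V_def by blast
    have "eventually (\<lambda>t. f t = 0) (at x)"
      using x(1) by (simp add: eventually_nhds_conv_at)
    from this x(2) have "eventually (\<lambda>t. False) (at x)"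
      by (rule eventually_elim2) simp
    then show False
      by simp
  qed
  moreover have "{a<..<b} \<subseteq> U \<union> V"
    using real_analytic_at_zero_dichotomy[OF an] unfolding U_def V_def by blast
  moreover have "c \<in> U"
    using real_analytic_at_zero_dichotomy[OF an[OF c]] ne unfolding U_def by blast
  ultimately have "V \<inter> {a<..<b} = {}"
    using connectedD[of "{a<..<b}" U V] c by auto
  then have "t \<in> U"
    using \<open>{a<..<b} \<subseteq> U \<union> V\<close> t by blast
  then show ?thesis
    unfolding U_def by (auto dest: eventually_nhds_x_imp_x)
qed

section \<open>Branches on intervals: uniqueness up to renumbering, and gluing\<close>

definition branches_on ::
    "nat \<Rightarrow> (real \<Rightarrow> complex mat) \<Rightarrow> real \<Rightarrow> real \<Rightarrow> (nat \<Rightarrow> real \<Rightarrow> real) \<Rightarrow> bool" where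
  "branches_on n L a b F \<longleftrightarrow> (\<forall>t\<in>{a<..<b}. (\<forall>i<n. real_analytic_at (F i) t) \<and>
     (\<forall>z. eig_mult (L t) z = card {i. i < n \<and> complex_of_real (F i t) = z}))"

lemma branches_on_real_analytic_at:
  "branches_on n L a b F \<Longrightarrow> t \<in> {a<..<b} \<Longrightarrow> i < n \<Longrightarrow> real_analytic_at (F i) t"
  unfolding branches_on_def by blast

lemma branches_on_eig_mult:
  "branches_on n L a b F \<Longrightarrow> t \<in> {a<..<b} \<Longrightarrow>
    eig_mult (L t) z = card {i. i < n \<and> complex_of_real (F i t) = z}"
  unfolding branches_on_def by blast

lemma branches_on_subset:
  "branches_on n L a b F \<Longrightarrow> a \<le> c \<Longrightarrow> d \<le> b \<Longrightarrow> branches_on n L c d F"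
  unfolding branches_on_def by auto

text \<open>Some \<open>t\<close> near \<open>c\<close> avoids all coincidences of the finitely many
  pairs \<open>F i\<close>, \<open>G j\<close> that differ in a punctured neighbourhood of
  \<open>c\<close>. At this \<open>t\<close> equality of the spectra gives a permutation, and each
  pair it matches must have coincidences accumulating at \<open>c\<close>, hence agrees on the whole
  interval.\<close>

lemma branches_on_permutes:
  assumes F: "branches_on n L a b F" and G: "branches_on n L a b G" and "a < b"
  obtains p where "p permutes {..<n}" "\<And>i t. i < n \<Longrightarrow> t \<in> {a<..<b} \<Longrightarrow> F i t = G (p i) t"
proof -
  define c where "c = (a + b) / 2"
  have c: "c \<in> {a<..<b}"
    using \<open>a < b\<close> by (simp add: c_def)
  have an: "real_analytic_at (\<lambda>t. F i t - G j t) t" if "i < n" "j < n" "t \<in> {a<..<b}" for i j t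
    using branches_on_real_analytic_at[OF F that(3,1)] branches_on_real_analytic_at[OF G that(3,2)]
    by (rule real_analytic_at_diff)
  define B where "B = {(i, j) \<in> {..<n} \<times> {..<n}. eventually (\<lambda>t. F i t - G j t \<noteq> 0) (at c)}"
  have "finite B"
    unfolding B_def by (rule finite_subset[of _ "{..<n} \<times> {..<n}"]) auto
  then have "eventually (\<lambda>t. \<forall>x\<in>B. F (fst x) t - G (snd x) t \<noteq> 0) (at c)"
    by (rule eventually_ball_finite) (auto simp: B_def)
  moreover have "eventually (\<lambda>t. t \<in> {a<..<b}) (at c)"
    using c by (intro eventually_at_in_open') auto
  ultimately have "eventually (\<lambda>t. (\<forall>x\<in>B. F (fst x) t - G (snd x) t \<noteq> 0) \<and> t \<in> {a<..<b}) (at c)"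
    by (rule eventually_conj)
  from eventually_happens'[OF _ this] obtain t
    where t: "t \<in> {a<..<b}" "\<forall>x\<in>B. F (fst x) t - G (snd x) t \<noteq> 0"
    by auto
  have "image_mset (\<lambda>i. F i t) (mset_set {..<n}) = image_mset (\<lambda>i. G i t) (mset_set {..<n})"
  proof (rule multiset_eqI)
    fix y
    have "card {i. i < n \<and> complex_of_real (F i t) = of_real y} = card {i. i < n \<and> complex_of_real (G i t) = of_real y}"
      by (simp only: flip: branches_on_eig_mult[OF F t(1)] branches_on_eig_mult[OF G t(1)])
    then show "count (image_mset (\<lambda>i. F i t) (mset_set {..<n})) y = count (image_mset (\<lambda>i. G i t) (mset_set {..<n})) y"
      by (simp add: count_image_mset_eq_card_vimage)
  qed
  then obtain p where p: "p permutes {..<n}" "\<forall>i\<in>{..<n}. F i t = G (p i) t"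
    using image_mset_eq_implies_permutes[of "{..<n}" "\<lambda>i. F i t" "\<lambda>i. G i t"] by auto
  have "F i s = G (p i) s" if i: "i < n" and s: "s \<in> {a<..<b}" for i s
  proof -
    have pi: "p i < n"
      using permutes_in_image[OF p(1), of i] i by simp
    have "(i, p i) \<notin> B"
      using bspec[OF t(2), of "(i, p i)"] p(2) i by auto
    then have ne: "\<not> eventually (\<lambda>t. F i t - G (p i) t \<noteq> 0) (at c)"
      using i pi by (simp add: B_def)
    have "F i s - G (p i) s = 0"
    proof (rule real_analytic_identity[where f="\<lambda>t. F i t - G (p i) t"])
      show "real_analytic_at (\<lambda>t. F i t - G (p i) t) t" if "t \<in> {a<..<b}" for t
        using i pi that by (rule an)
    qed fact+
    then show ?thesis
      by simp
  qed
  then show thesis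
    using that p(1) by blast
qed

text \<open>Only \<open>G\<close> is renumbered. Since \<open>F\<close> keeps its indexing, repeated
  extensions are compatible and have a common limit.\<close>

lemma branches_on_glue:
  assumes F: "branches_on n L a b F" and G: "branches_on n L c d G"
    and overlap: "max a c < min b d"
  shows "\<exists>H. branches_on n L (min a c) (max b d) H \<and> (\<forall>i<n. \<forall>t\<in>{a<..<b}. H i t = F i t)"
proof -
  have "branches_on n L (max a c) (min b d) F" "branches_on n L (max a c) (min b d) G"
    using F G by (auto intro: branches_on_subset)
  then obtain p where p: "p permutes {..<n}"
    "\<And>i t. i < n \<Longrightarrow> t \<in> {max a c<..<min b d} \<Longrightarrow> F i t = G (p i) t"
    using overlap by (rule branches_on_permutes) blast
  define H where "H i t = (if t \<in> {a<..<b} then F i t else G (p i) t)" for i t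
  have HG: "H i t = G (p i) t" if "i < n" "t \<in> {c<..<d}" for i t
    using p(2)[OF that(1), of t] that(2) by (auto simp: H_def)
  have pn: "p i < n" if "i < n" for i
    using permutes_in_image[OF p(1), of i] that by simp
  have near: "\<exists>e>0. \<forall>s. \<bar>s - t\<bar> < e \<longrightarrow> s \<in> {x<..<y}" if "t \<in> {x<..<y}" for t x y :: real
    using that by (intro exI[of _ "min (t - x) (y - t)"]) auto
  have "branches_on n L (min a c) (max b d) H"
    unfolding branches_on_def
  proof
    fix t assume "t \<in> {min a c<..<max b d}"
    then consider "t \<in> {a<..<b}" | "t \<in> {c<..<d}"
      using overlap by fastforce
    then show "(\<forall>i<n. real_analytic_at (H i) t) \<and>
        (\<forall>z. eig_mult (L t) z = card {i. i < n \<and> complex_of_real (H i t) = z})"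
    proof cases
      case 1
      obtain e where e: "e > 0" "\<And>s. \<bar>s - t\<bar> < e \<Longrightarrow> s \<in> {a<..<b}"
        using near[OF 1] by blast
      have "real_analytic_at (H i) t" if "i < n" for i
      proof (rule real_analytic_at_cong[OF _ e(1)])
        show "real_analytic_at (F i) t"
          using F 1 that by (rule branches_on_real_analytic_at)
        show "H i s = F i s" if "\<bar>s - t\<bar> < e" for s
          using e(2)[OF that] unfolding H_def by simp
      qed
      moreover have "H i t = F i t" for i
        using 1 unfolding H_def by simp
      ultimately show ?thesis
        using branches_on_eig_mult[OF F 1] by simp
    next
      case 2
      obtain e where e: "e > 0" "\<And>s. \<bar>s - t\<bar> < e \<Longrightarrow> s \<in> {c<..<d}"
        using near[OF 2] by blast
      have "real_analytic_at (H i) t" if i: "i < n" for i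
      proof (rule real_analytic_at_cong[OF _ e(1)])
        show "real_analytic_at (G (p i)) t"
          using G 2 pn[OF i] by (rule branches_on_real_analytic_at)
        show "H i s = G (p i) s" if "\<bar>s - t\<bar> < e" for s
          using HG[OF i] e(2)[OF that] by blast
      qed
      moreover have "eig_mult (L t) z = card {i. i < n \<and> complex_of_real (H i t) = z}" for z
      proof -
        have "bij_betw p {i. i < n \<and> complex_of_real (H i t) = z} {j. j < n \<and> complex_of_real (G j t) = z}"
        proof (rule bij_betwI')
          fix i j assume "i \<in> {i. i < n \<and> complex_of_real (H i t) = z}" "j \<in> {i. i < n \<and> complex_of_real (H i t) = z}"
          show "(p i = p j) = (i = j)"
            using permutes_inj[OF p(1)] by (auto simp: inj_eq)
        next
          fix i assume "i \<in> {i. i < n \<and> complex_of_real (H i t) = z}"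
          then show "p i \<in> {j. j < n \<and> complex_of_real (G j t) = z}"
            using pn HG[OF _ 2] by auto
        next
          fix j assume j: "j \<in> {j. j < n \<and> complex_of_real (G j t) = z}"
          then obtain i where "i < n" "j = p i"
            using permutes_image[OF p(1)] by blast
          then show "\<exists>i\<in>{i. i < n \<and> complex_of_real (H i t) = z}. j = p i"
            using j HG[OF _ 2] by auto
        qed
        from bij_betw_same_card[OF this] show ?thesis
          using branches_on_eig_mult[OF G 2] by simp
      qed
      ultimately show ?thesis
        by blast
    qed
  qed
  moreover have "H i t = F i t" if "t \<in> {a<..<b}" for i t
    using that unfolding H_def by simp
  ultimately show ?thesis
    by blast
qed

text \<open>The branches are extended along the intervals \<open>(-N - 1, N + 1)\<close>, each family
  continuing the previous one with the same indexing.\<close>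

lemma is_eigenvalue_branches_if_local:
  assumes loc: "\<And>t0. \<exists>e>0. \<exists>F. branches_on n L (t0 - e) (t0 + e) F"
  shows "\<exists>\<mu>. is_eigenvalue_branches n L \<mu>"
proof -
  \<comment> \<open>\<open>Q\<close> asks for branches on slightly more than [a, b], so families
    over adjacent intervals overlap around the common endpoint, as the subdivision argument of
    \<open>Bolzano\<close> requires.\<close>
  define Q where "Q a b \<longleftrightarrow> (\<exists>e>0. \<exists>F. branches_on n L (a - e) (b + e) F)" for a b
  have Q: "Q a b" if "a \<le> b" for a b
    using that
  proof (induction a b rule: Bolzano)
    case (trans a b c)
    obtain e F where F: "e > 0" "branches_on n L (a - e) (b + e) F"
      using trans(1) unfolding Q_def by blast
    obtain e' G where G: "e' > 0" "branches_on n L (b - e') (c + e') G"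
      using trans(2) unfolding Q_def by blast
    have "\<exists>H. branches_on n L (min (a - e) (b - e')) (max (b + e) (c + e')) H \<and>
        (\<forall>i<n. \<forall>t\<in>{a - e<..<b + e}. H i t = F i t)"
      using trans(3,4) F(1) G(1) by (intro branches_on_glue[OF F(2) G(2)]) auto
    then obtain H where "branches_on n L (min (a - e) (b - e')) (max (b + e) (c + e')) H"
      by blast
    then have "branches_on n L (a - min e e') (c + min e e') H"
      by (rule branches_on_subset) (use trans(3,4) in auto)
    then show ?case
      unfolding Q_def using F(1) G(1) by (intro exI[of _ "min e e'"]) auto
  next
    case (local x)
    obtain e F where F: "e > 0" "branches_on n L (x - e) (x + e) F"
      using loc[of x] by blast
    have "Q a b" if ab: "a \<le> x \<and> x \<le> b \<and> b - a < e / 2" for a b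
    proof -
      have "branches_on n L (a - e / 2) (b + e / 2) F"
        using F(2) by (rule branches_on_subset) (use ab in auto)
      then show ?thesis
        unfolding Q_def using F(1) by (intro exI[of _ "e / 2"]) auto
    qed
    then show ?case
      using F(1) by (intro exI[of _ "e / 2"]) auto
  qed
  have ex: "\<exists>F. branches_on n L (- real N - 1) (real N + 1) F" for N
  proof -
    have "Q (- real N - 1) (real N + 1)"
      by (rule Q) simp
    then obtain e F where "e > 0" "branches_on n L (- real N - 1 - e) (real N + 1 + e) F"
      unfolding Q_def by blast
    then show ?thesis
      by (intro exI[of _ F]) (rule branches_on_subset, auto)
  qed
  have "\<exists>f. \<forall>N. branches_on n L (- real N - 1) (real N + 1) (f N) \<and>
      (\<forall>i<n. \<forall>t\<in>{- real N - 1<..<real N + 1}. f (Suc N) i t = f N i t)"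
  proof (rule dependent_nat_choice)
    show "\<exists>F. branches_on n L (- real 0 - 1) (real 0 + 1) F"
      by (rule ex)
    fix F N assume F: "branches_on n L (- real N - 1) (real N + 1) F"
    obtain G where G: "branches_on n L (- real (Suc N) - 1) (real (Suc N) + 1) G"
      using ex by blast
    have "\<exists>H. branches_on n L (min (- real N - 1) (- real (Suc N) - 1)) (max (real N + 1) (real (Suc N) + 1)) H \<and>
        (\<forall>i<n. \<forall>t\<in>{- real N - 1<..<real N + 1}. H i t = F i t)"
      by (rule branches_on_glue[OF F G]) auto
    moreover have "min (- real N - 1) (- real (Suc N) - 1) = - real (Suc N) - 1"
      "max (real N + 1) (real (Suc N) + 1) = real (Suc N) + 1"
      by auto
    ultimately show "\<exists>H. branches_on n L (- real (Suc N) - 1) (real (Suc N) + 1) H \<and>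
        (\<forall>i<n. \<forall>t\<in>{- real N - 1<..<real N + 1}. H i t = F i t)"
      by simp
  qed
  then obtain f where f: "\<And>N. branches_on n L (- real N - 1) (real N + 1) (f N)"
    and fS: "\<And>N i t. i < n \<Longrightarrow> t \<in> {- real N - 1<..<real N + 1} \<Longrightarrow> f (Suc N) i t = f N i t"
    by blast
  have mono: "f M i t = f N i t" if "N \<le> M" "i < n" "\<bar>t\<bar> < real N + 1" for N M i t
    using that(1)
  proof (induction rule: dec_induct)
    case (step k)
    have "real N \<le> real k"
      using step.hyps(1) by simp
    then have "t \<in> {- real k - 1<..<real k + 1}"
      using that(3) unfolding greaterThanLessThan_iff by linarith
    then show ?case
      using fS[OF that(2), of t k] step.IH by simp
  qed simp
  \<comment> \<open>The index satisfies |t| < N + 1, so \<open>t\<close> lies in the interval of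
    \<open>f N\<close>; by \<open>mono\<close> every other admissible index gives the same
    value.\<close>
  define \<mu> where "\<mu> i t = f (nat \<lceil>\<bar>t\<bar>\<rceil>) i t" for i and t :: real
  have \<mu>: "\<mu> i t = f N i t" if "i < n" "\<bar>t\<bar> < real N + 1" for i t N
  proof -
    have "\<bar>t\<bar> < real (nat \<lceil>\<bar>t\<bar>\<rceil>) + 1"
      by linarith
    then show ?thesis
      using mono[of N "nat \<lceil>\<bar>t\<bar>\<rceil>" i t] mono[of "nat \<lceil>\<bar>t\<bar>\<rceil>" N i t] that
      unfolding \<mu>_def by (cases "N \<le> nat \<lceil>\<bar>t\<bar>\<rceil>") auto
  qed
  have "is_eigenvalue_branches n L \<mu>"
    unfolding is_eigenvalue_branches_def
  proof (intro conjI allI impI)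
    fix i assume i: "i < n"
    show "real_analytic (\<mu> i)"
    proof (rule real_analytic_if_real_analytic_at)
      fix t :: real
      define N where "N = nat \<lceil>\<bar>t\<bar>\<rceil>"
      have N: "\<bar>t\<bar> < real N + 1"
        unfolding N_def by linarith
      then have "t \<in> {- real N - 1<..<real N + 1}"
        unfolding greaterThanLessThan_iff by linarith
      then have "real_analytic_at (f N i) t"
        by (rule branches_on_real_analytic_at[OF f _ i])
      then show "real_analytic_at (\<mu> i) t"
        by (rule real_analytic_at_cong[where e="real N + 1 - \<bar>t\<bar>"]) (use N in \<open>auto intro!: \<mu>[OF i]\<close>)
    qed
  next
    fix t :: real and z
    define N where "N = nat \<lceil>\<bar>t\<bar>\<rceil>"
    have N: "\<bar>t\<bar> < real N + 1"
      unfolding N_def by linarith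
    then have "t \<in> {- real N - 1<..<real N + 1}"
      unfolding greaterThanLessThan_iff by linarith
    then have "eig_mult (L t) z = card {i. i < n \<and> complex_of_real (f N i t) = z}"
      by (rule branches_on_eig_mult[OF f])
    moreover have "{i. i < n \<and> complex_of_real (f N i t) = z} = {i. i < n \<and> complex_of_real (\<mu> i t) = z}"
      using \<mu>[OF _ N] by auto
    ultimately show "eig_mult (L t) z = card {i. i < n \<and> complex_of_real (\<mu> i t) = z}"
      by simp
  qed
  then show ?thesis
    by blast
qed

section \<open>Existence of the branches of a Hermitian pencil\<close>

lemma order_linprod: "Polynomial.order z (linprod as) = card {i. i < length as \<and> as ! i = z}"
proof -
  have nz: "linprod bs \<noteq> 0" for bs
    using coeff_linprod_length[of bs] by (metis coeff_0 zero_neq_one)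
  have "Polynomial.order z (linprod as) = length (filter (\<lambda>a. a = z) as)"
  proof (induction as)
    case (Cons a as)
    have "Polynomial.order z (linprod (a # as)) = Polynomial.order z [:- a, 1:] + Polynomial.order z (linprod as)"
      unfolding linprod_simps(2) using nz[of "a # as"] by (intro order_mult) simp
    then show ?case
      using Cons by (simp add: order_linear' del: linprod_simps)
  qed (simp add: order_0I)
  then show ?thesis
    by (simp add: length_filter_conv_card)
qed

lemma hermitian_mat_index:
  assumes "A \<in> carrier_mat n n" "hermitian_mat A" "i < n" "j < n"
  shows "A $$ (i, j) = cnj (A $$ (j, i))"
proof -
  have "A $$ (i, j) = mat_adjoint A $$ (i, j)"
    using assms(2) by (simp add: hermitian_mat_def)
  also have "\<dots> = cnj (A $$ (j, i))"
    using assms(1,3,4) unfolding mat_adjoint_def by (simp add: mat_of_rows_index conjugate_complex_def)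
  finally show ?thesis .
qed

lemma hermitian_mat_eigenvalue_real:
  assumes A: "A \<in> carrier_mat n n" and herm: "hermitian_mat A" and ev: "eigenvalue A k"
  shows "k \<in> \<real>"
proof -
  obtain v where v: "v \<in> carrier_vec n" "v \<noteq> 0\<^sub>v n" "A *\<^sub>v v = k \<cdot>\<^sub>v v"
    using ev A unfolding eigenvalue_def eigenvector_def by auto
  have Av: "(\<Sum>j<n. A $$ (i, j) * v $ j) = k * v $ i" if "i < n" for i
  proof -
    have "(A *\<^sub>v v) $ i = (\<Sum>j<n. A $$ (i, j) * v $ j)"
      using that A v(1) by (simp add: scalar_prod_def atLeast0LessThan)
    then show ?thesis
      using v(1,3) that by simp
  qed
  \<comment> \<open>\<open>S\<close> is the Hermitian form of \<open>A\<close> at \<open>v\<close>: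
    symmetry makes it real, and the eigenvector equation makes it \<open>k\<close> times the squared
    norm \<open>N\<close>.\<close>
  define S where "S = (\<Sum>i<n. \<Sum>j<n. cnj (v $ i) * A $$ (i, j) * v $ j)"
  define N where "N = (\<Sum>i<n. (norm (v $ i))\<^sup>2)"
  have "cnj S = (\<Sum>i<n. \<Sum>j<n. v $ i * cnj (A $$ (i, j)) * cnj (v $ j))"
    by (simp add: S_def)
  also have "\<dots> = (\<Sum>i<n. \<Sum>j<n. cnj (v $ j) * A $$ (j, i) * v $ i)"
  proof (intro sum.cong refl)
    fix i j assume "i \<in> {..<n}" "j \<in> {..<n}"
    then have "A $$ (j, i) = cnj (A $$ (i, j))"
      using hermitian_mat_index[OF A herm, of j i] by simp
    then show "v $ i * cnj (A $$ (i, j)) * cnj (v $ j) = cnj (v $ j) * A $$ (j, i) * v $ i"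
      by simp
  qed
  also have "\<dots> = S"
    unfolding S_def by (rule sum.swap)
  finally have "S \<in> \<real>"
    by (simp add: Reals_cnj_iff)
  have "S = (\<Sum>i<n. cnj (v $ i) * (\<Sum>j<n. A $$ (i, j) * v $ j))"
    by (simp add: S_def sum_distrib_left mult.assoc)
  also have "\<dots> = (\<Sum>i<n. k * of_real ((norm (v $ i))\<^sup>2))"
  proof (intro sum.cong refl)
    fix i assume "i \<in> {..<n}"
    then show "cnj (v $ i) * (\<Sum>j<n. A $$ (i, j) * v $ j) = k * of_real ((norm (v $ i))\<^sup>2)"
      unfolding complex_norm_square using Av[of i] by simp
  qed
  also have "\<dots> = k * of_real N"
    by (simp add: N_def sum_distrib_left)
  finally have S: "S = k * of_real N" .
  have "\<exists>i<n. v $ i \<noteq> 0"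
  proof (rule ccontr)
    assume "\<not> ?thesis"
    then have "v = 0\<^sub>v n"
      using v(1) by (intro eq_vecI) auto
    then show False
      using v(2) by simp
  qed
  then obtain i where i: "i < n" "v $ i \<noteq> 0"
    by blast
  have "0 < (norm (v $ i))\<^sup>2"
    using i by simp
  also have "\<dots> \<le> N"
    unfolding N_def using i by (intro member_le_sum) auto
  finally have "k = S / of_real N"
    by (simp add: S)
  then show ?thesis
    using \<open>S \<in> \<real>\<close> by simp
qed

text \<open>By the Leibniz formula the coefficients are polynomials in the matrix entries.\<close>

lemma holo_poly_char_poly:
  assumes "\<And>i j. i < n \<Longrightarrow> j < n \<Longrightarrow> g i j holomorphic_on S"
  shows "holo_poly (\<lambda>z. char_poly (mat n n (\<lambda>(i, j). g i j z))) S"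
proof -
  define e where "e i j z = (if i = j then [:0, 1:] else 0) + [:- g i j z:]" for i j z
  have e: "char_poly (mat n n (\<lambda>(i, j). g i j z)) =
      (\<Sum>p\<in>{p. p permutes {0..<n}}. signof p * (\<Prod>i = 0..<n. e i (p i) z))" for z
  proof -
    have "char_poly_matrix (mat n n (\<lambda>(i, j). g i j z)) \<in> carrier_mat n n"
      by simp
    then have "char_poly (mat n n (\<lambda>(i, j). g i j z)) = (\<Sum>p\<in>{p. p permutes {0..<n}}. signof p *
        (\<Prod>i = 0..<n. char_poly_matrix (mat n n (\<lambda>(i, j). g i j z)) $$ (i, p i)))"
      unfolding char_poly_def by (rule det_def')
    also have "\<dots> = (\<Sum>p\<in>{p. p permutes {0..<n}}. signof p * (\<Prod>i = 0..<n. e i (p i) z))"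
    proof (intro sum.cong arg_cong2[where f="(*)"] prod.cong refl)
      fix p i assume "p \<in> {p. p permutes {0..<n}}" "i \<in> {0..<n}"
      then have "i < n" "p i < n"
        using permutes_in_image[of p "{0..<n}" i] by auto
      then show "char_poly_matrix (mat n n (\<lambda>(i, j). g i j z)) $$ (i, p i) = e i (p i) z"
        by (simp add: char_poly_matrix_def e_def)
    qed
    finally show ?thesis .
  qed
  have "holo_poly (e i j) S" if "i < n" "j < n" for i j
    unfolding e_def using assms[OF that]
    by (intro holo_poly_add holo_poly_const holo_poly_pCons holomorphic_on_minus)
  then have "holo_poly (\<lambda>z. \<Prod>i = 0..<n. e i (p i) z) S" if "p permutes {0..<n}" for p
    using permutes_in_image[OF that] by (intro holo_poly_prod) auto
  then show ?thesis
    unfolding e by (intro holo_poly_sum holo_poly_mult holo_poly_const) auto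
qed

lemma branches_on_near:
  assumes "analytic_hermitian_pencil n L"
  shows "\<exists>e>0. \<exists>F. branches_on n L (t0 - e) (t0 + e) F"
proof -
  have L: "L t \<in> carrier_mat n n" "hermitian_mat (L t)" for t
    using assms unfolding analytic_hermitian_pencil_def by auto
  have "\<exists>r>0. \<exists>g. g holomorphic_on ball 0 r \<and> (\<forall>t. \<bar>t\<bar> < r \<longrightarrow> g (complex_of_real t) = L (t0 + t) $$ x)"
    if "x \<in> {..<n} \<times> {..<n}" for x
  proof -
    have "real_analytic (\<lambda>t. L t $$ x)"
      using assms that unfolding analytic_hermitian_pencil_def by (cases x) auto
    then show ?thesis
      by (rule real_analytic_holomorphic_extension)
  qed
  then have "\<forall>x\<in>{..<n} \<times> {..<n}. \<exists>r g. r > 0 \<and> g holomorphic_on ball 0 r \<and>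
      (\<forall>t. \<bar>t\<bar> < r \<longrightarrow> g (complex_of_real t) = L (t0 + t) $$ x)"
    by blast
  from bchoice[OF this] obtain \<rho> where \<rho>: "\<forall>x\<in>{..<n} \<times> {..<n}. \<exists>g. \<rho> x > 0 \<and> g holomorphic_on ball 0 (\<rho> x) \<and>
      (\<forall>t. \<bar>t\<bar> < \<rho> x \<longrightarrow> g (complex_of_real t) = L (t0 + t) $$ x)" ..
  from bchoice[OF \<rho>] obtain g where g: "\<forall>x\<in>{..<n} \<times> {..<n}. \<rho> x > 0 \<and> g x holomorphic_on ball 0 (\<rho> x) \<and>
      (\<forall>t. \<bar>t\<bar> < \<rho> x \<longrightarrow> g x (complex_of_real t) = L (t0 + t) $$ x)" ..
  \<comment> \<open>The entries have extensions of different radii. The element 1 keeps the set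
    nonempty when \<open>n = 0\<close>.\<close>
  define r where "r = Min (insert 1 (\<rho> ` ({..<n} \<times> {..<n})))"
  have r: "r > 0"
    unfolding r_def using g by (subst Min_gr_iff) auto
  have r_le: "r \<le> \<rho> x" if "x \<in> {..<n} \<times> {..<n}" for x
    unfolding r_def using that by (intro Min_le) auto
  \<comment> \<open>\<open>M z\<close> need not be Hermitian for nonreal \<open>z\<close>; the link
    to \<open>L\<close> holds at real parameters, where real roots are demanded.\<close>
  define M where "M z = mat n n (\<lambda>(i, j). g (i, j) z)" for z
  have M_eq: "M (of_real t) = L (t0 + t)" if t: "\<bar>t\<bar> < r" for t
  proof (rule eq_matI)
    fix i j assume "i < dim_row (L (t0 + t))" "j < dim_col (L (t0 + t))"
    then have ij: "i < n" "j < n"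
      using L(1)[of "t0 + t"] by auto
    then have "\<bar>t\<bar> < \<rho> (i, j)"
      using r_le[of "(i, j)"] t by auto
    then show "M (of_real t) $$ (i, j) = L (t0 + t) $$ (i, j)"
      using g ij by (simp add: M_def)
  qed (use L(1)[of "t0 + t"] in \<open>auto simp: M_def\<close>)
  define P where "P z = char_poly (M z)" for z
  have "holo_poly P (ball 0 r)"
    unfolding P_def M_def
  proof (rule holo_poly_char_poly)
    fix i j assume "i < n" "j < n"
    then have x: "(i, j) \<in> {..<n} \<times> {..<n}"
      by simp
    show "g (i, j) holomorphic_on ball 0 r"
      using g x by (intro holomorphic_on_subset[OF _ subset_ball[OF r_le[OF x]]]) blast
  qed
  moreover have "degree (P z) = n \<and> coeff (P z) n = 1" for z
    unfolding P_def by (rule degree_monic_char_poly) (simp add: M_def)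
  moreover have "x \<in> \<real>" if "\<bar>t\<bar> < r" "poly (P (of_real t)) x = 0" for t :: real and x
  proof -
    have "eigenvalue (L (t0 + t)) x"
      using that(2) unfolding P_def M_eq[OF that(1)] eigenvalue_root_char_poly[OF L(1)] .
    then show ?thesis
      by (rule hermitian_mat_eigenvalue_real[OF L])
  qed
  ultimately have fam: "hyperbolic_family P n r"
    unfolding hyperbolic_family_def using r by blast
  then obtain s fs where s: "s > 0" and fs: "\<And>f. f \<in> set fs \<Longrightarrow> f holomorphic_on ball 0 s"
    and P: "\<And>z. z \<in> ball 0 s \<Longrightarrow> P z = linprod (map (\<lambda>f. f z) fs)"
    using hyperbolic_family_splits unfolding splits_near_0_def by blast
  have len: "length fs = n"
    using hyperbolic_familyD(3)[OF fam, of 0] r P[of 0] s by simp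
  define e where "e = min r s"
  define F where "F i t = Re ((fs ! i) (of_real (t - t0)))" for i t
  have F: "(fs ! i) (of_real t) = of_real (F i (t0 + t))" if i: "i < n" and t: "\<bar>t\<bar> < e" for i t
  proof -
    have "poly (P (of_real t)) ((fs ! i) (of_real t)) = 0"
      using t i len by (subst P) (auto simp: e_def poly_linprod_eq_0_iff)
    then have "(fs ! i) (of_real t) \<in> \<real>"
      using hyperbolic_familyD(5)[OF fam, of t] t by (simp add: e_def)
    then show ?thesis
      by (simp add: F_def)
  qed
  have "branches_on n L (t0 - e) (t0 + e) F"
    unfolding branches_on_def
  proof (intro ballI conjI allI impI)
    fix t i assume t: "t \<in> {t0 - e<..<t0 + e}" and i: "i < n"
    define u where "u = t - t0"
    \<comment> \<open>The extension about \<open>t0\<close> also serves \<open>t\<close> after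
      translation by \<open>u\<close>: a ball of radius \<open>d\<close> about \<open>u\<close>
      stays inside the ball of radius \<open>e\<close>.\<close>
    define d where "d = e - \<bar>u\<bar>"
    have d: "d > 0"
      using t by (auto simp: d_def u_def)
    have "(\<lambda>z. (fs ! i) (z + of_real u)) holomorphic_on ball 0 d"
    proof (rule holomorphic_on_compose_gen[unfolded o_def, where g="fs ! i" and t="ball 0 s"])
      show "(\<lambda>z. z + complex_of_real u) holomorphic_on ball 0 d"
        by (intro holomorphic_intros)
      show "fs ! i holomorphic_on ball 0 s"
        using i len by (intro fs) simp
      show "(\<lambda>z. z + complex_of_real u) ` ball 0 d \<subseteq> ball 0 s"
      proof
        fix y assume "y \<in> (\<lambda>z. z + complex_of_real u) ` ball 0 d"
        then obtain z where z: "norm z < d" "y = z + complex_of_real u"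
          by auto
        then have "norm y < e"
          using norm_triangle_ineq[of z "of_real u"] by (simp add: d_def)
        then show "y \<in> ball 0 s"
          by (simp add: e_def)
      qed
    qed
    moreover have "(fs ! i) (of_real x + of_real u) = of_real (F i (t + x))" if x: "\<bar>x\<bar> < d" for x
    proof -
      have "\<bar>x + u\<bar> < e"
        using x unfolding d_def by linarith
      then have "(fs ! i) (of_real (x + u)) = of_real (F i (t0 + (x + u)))"
        by (rule F[OF i])
      moreover have "t0 + (x + u) = t + x"
        by (simp add: u_def)
      ultimately show ?thesis
        by simp
    qed
    ultimately show "real_analytic_at (F i) t"
      unfolding real_analytic_at_def using d
      by (intro exI[of _ d] conjI exI[of _ "\<lambda>z. (fs ! i) (z + of_real u)"]) auto
  next
    fix t z assume t: "t \<in> {t0 - e<..<t0 + e}"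
    define u where "u = t - t0"
    have u: "\<bar>u\<bar> < e" "t = t0 + u"
      using t by (auto simp: u_def)
    have "eig_mult (L t) z = Polynomial.order z (P (of_real u))"
      using u M_eq[of u] by (simp add: eig_mult_def P_def e_def)
    also have "\<dots> = Polynomial.order z (linprod (map (\<lambda>f. f (of_real u)) fs))"
      using u by (subst P) (auto simp: e_def)
    also have "\<dots> = card {i. i < n \<and> complex_of_real (F i t) = z}"
      unfolding order_linprod u(2) using F[OF _ u(1)] len by (intro arg_cong[of _ _ card]) auto
    finally show "eig_mult (L t) z = card {i. i < n \<and> complex_of_real (F i t) = z}" .
  qed
  then show ?thesis
    using r s by (intro exI[of _ e]) (auto simp: e_def)
qed

lemma eigenvalue_branches:
  assumes "analytic_hermitian_pencil n L"
  shows "is_eigenvalue_branches n L (eigenvalue_branches n L)"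
proof -
  have "\<exists>\<mu>. is_eigenvalue_branches n L \<mu>"
    by (rule is_eigenvalue_branches_if_local) (rule branches_on_near[OF assms])
  then show ?thesis
    unfolding eigenvalue_branches_def by (rule someI_ex)
qed

section \<open>Sign changes of a branch\<close>

text \<open>The Krein signature is defined through real iterated derivatives, whereas Taylor
  expansion is available for the extension. Along the real line the complex derivative has the real
  derivative as its real part, and its imaginary part is 0 because the function is real
  there.\<close>

lemma real_analytic_at_higher_deriv:
  assumes "real_analytic_at f t0"
  obtains r g where "r > 0" "g holomorphic_on ball 0 r"
    "\<And>k t. \<bar>t\<bar> < r \<Longrightarrow> (deriv ^^ k) g (complex_of_real t) = of_real ((deriv ^^ k) f (t0 + t))"
    "\<And>k t. \<bar>t\<bar> < r \<Longrightarrow> ((deriv ^^ k) f has_real_derivative (deriv ^^ Suc k) f (t0 + t)) (at (t0 + t))"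
proof -
  obtain r g where r: "r > 0" and g: "g holomorphic_on ball 0 r"
    and gf: "\<And>t. \<bar>t\<bar> < r \<Longrightarrow> g (complex_of_real t) = of_real (f (t0 + t))"
    using assms unfolding real_analytic_at_def by blast
  have step: "(deriv ^^ Suc k) g (complex_of_real t) = of_real ((deriv ^^ Suc k) f (t0 + t)) \<and>
      ((deriv ^^ k) f has_real_derivative (deriv ^^ Suc k) f (t0 + t)) (at (t0 + t))"
    if IH: "\<And>t. \<bar>t\<bar> < r \<Longrightarrow> (deriv ^^ k) g (complex_of_real t) = of_real ((deriv ^^ k) f (t0 + t))"
      and t: "\<bar>t\<bar> < r" for k t
  proof -
    define G where "G = (deriv ^^ k) g"
    define D where "D = deriv G (of_real t)"
    have "G holomorphic_on ball 0 r"
      unfolding G_def using g by (rule holomorphic_higher_deriv) simp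
    then have "(G has_field_derivative D) (at (of_real t))"
      unfolding D_def by (rule holomorphic_derivI[OF _ open_ball]) (use t in simp)
    then have vd: "((\<lambda>s. G (of_real s)) has_vector_derivative D) (at t)"
      by (rule has_vector_derivative_real_field)
    have tr: "t \<in> {-r<..<r}"
      using t by auto
    have "((\<lambda>s. Re (G (of_real s))) has_real_derivative Re D) (at t)"
      unfolding has_real_derivative_iff_has_vector_derivative
      using vd by (rule bounded_linear.has_vector_derivative[OF bounded_linear_Re])
    then have "((\<lambda>s. (deriv ^^ k) f (t0 + s)) has_real_derivative Re D) (at t)"
      by (rule has_field_derivative_transform_within_open[OF _ _ tr])
        (auto simp: G_def IH abs_less_iff)
    then have "((deriv ^^ k) f has_real_derivative Re D) (at (t0 + t))"
      using DERIV_shift[of "(deriv ^^ k) f" "Re D" t t0] by (simp add: add.commute)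
    moreover from this have "(deriv ^^ Suc k) f (t0 + t) = Re D"
      by (simp add: DERIV_imp_deriv)
    moreover have "Im D = 0"
    proof -
      have "((\<lambda>s. Im (G (of_real s))) has_real_derivative Im D) (at t)"
        unfolding has_real_derivative_iff_has_vector_derivative
        using vd by (rule bounded_linear.has_vector_derivative[OF bounded_linear_Im])
      then have "((\<lambda>s. 0) has_real_derivative Im D) (at t)"
        by (rule has_field_derivative_transform_within_open[OF _ _ tr])
          (auto simp: G_def IH abs_less_iff)
      then show ?thesis
        using DERIV_unique DERIV_const by blast
    qed
    moreover have "(deriv ^^ Suc k) g (of_real t) = D"
      by (simp add: D_def G_def)
    ultimately show ?thesis
      by (simp add: complex_eq_iff)
  qed
  have ext: "\<forall>t. \<bar>t\<bar> < r \<longrightarrow> (deriv ^^ k) g (complex_of_real t) = of_real ((deriv ^^ k) f (t0 + t))" for k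
  proof (induction k)
    case 0
    then show ?case
      using gf by simp
  next
    case (Suc k)
    then show ?case
      using step[of k] by blast
  qed
  then have "((deriv ^^ k) f has_real_derivative (deriv ^^ Suc k) f (t0 + t)) (at (t0 + t))"
    if "\<bar>t\<bar> < r" for k t
    using step[of k t] that by blast
  then show thesis
    using that[OF r g] ext by blast
qed

text \<open>\<open>LEAST\<close> is informative only if some derivative is nonzero; if all were
  zero, the Taylor series of the extension would make \<open>f\<close> vanish near
  \<open>t0\<close>.\<close>

lemma vanishing_order_properties:
  assumes an: "real_analytic_at f t0" and nz: "\<not> eventually (\<lambda>t. f t = 0) (nhds t0)"
  shows "(deriv ^^ vanishing_order f t0) f t0 \<noteq> 0"
    and "k < vanishing_order f t0 \<Longrightarrow> (deriv ^^ k) f t0 = 0"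
proof -
  have "\<exists>m. (deriv ^^ m) f t0 \<noteq> 0"
  proof (rule ccontr)
    assume zero: "\<not> ?thesis"
    show False
      using an
    proof (rule real_analytic_at_higher_deriv)
      fix r g
      assume r: "r > 0" and g: "g holomorphic_on ball 0 r"
        and d: "\<And>k t. \<bar>t\<bar> < r \<Longrightarrow> (deriv ^^ k) g (complex_of_real t) = of_real ((deriv ^^ k) f (t0 + t))"
      have dg: "(deriv ^^ k) g 0 = 0" for k
        using d[of 0 k] r zero by simp
      have "f t = 0" if t: "\<bar>t - t0\<bar> < r" for t
      proof -
        have "(\<lambda>k. (deriv ^^ k) g 0 / fact k * (of_real (t - t0) - 0) ^ k) sums g (of_real (t - t0))"
          using t by (intro holomorphic_power_series[OF g]) (simp add: dist_norm del: of_real_diff)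
        then have "g (of_real (t - t0)) = 0"
          unfolding dg using sums_unique2[OF _ sums_zero] by simp
        then show ?thesis
          using d[OF t, of 0] by (simp del: of_real_diff)
      qed
      then have "eventually (\<lambda>t. f t = 0) (nhds t0)"
        unfolding eventually_nhds_metric using r by (auto simp: dist_norm)
      then show False
        using nz by simp
    qed
  qed
  then show "(deriv ^^ vanishing_order f t0) f t0 \<noteq> 0"
    unfolding vanishing_order_def by (rule LeastI_ex)
  show "k < vanishing_order f t0 \<Longrightarrow> (deriv ^^ k) f t0 = 0"
    unfolding vanishing_order_def using not_less_Least by blast
qed

text \<open>In Taylor's formula of order \<open>m\<close> only the Lagrange remainder survives, and
  the derivative in it keeps the sign of \<open>c\<close> near \<open>t0\<close>. Stating the result
  as positivity of a product treats both signs of \<open>c\<close> and both sides of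
  \<open>t0\<close> at once.\<close>

lemma sign_near_zero:
  assumes an: "real_analytic_at f t0" and nz: "\<not> eventually (\<lambda>t. f t = 0) (nhds t0)"
  defines "m \<equiv> vanishing_order f t0"
  defines "c \<equiv> (deriv ^^ m) f t0"
  shows "\<exists>e>0. \<forall>t. t \<noteq> t0 \<and> \<bar>t - t0\<bar> < e \<longrightarrow> f t * (c * (t - t0) ^ m) > 0"
  using an
proof (rule real_analytic_at_higher_deriv)
  fix r g
  assume r: "r > 0"
    and D': "\<And>k t. \<bar>t\<bar> < r \<Longrightarrow> ((deriv ^^ k) f has_real_derivative (deriv ^^ Suc k) f (t0 + t)) (at (t0 + t))"
  have D: "((deriv ^^ k) f has_real_derivative (deriv ^^ Suc k) f t) (at t)" if "\<bar>t - t0\<bar> < r" for k t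
    using D'[OF that, of k] by simp
  have c: "c \<noteq> 0" and lower: "\<And>k. k < m \<Longrightarrow> (deriv ^^ k) f t0 = 0"
    unfolding c_def m_def using vanishing_order_properties[OF an nz] by blast+
  have "isCont (\<lambda>t. (deriv ^^ m) f t * c) t0"
    using DERIV_isCont[OF D[of t0 m]] r by (intro continuous_intros) simp
  then have "((\<lambda>t. (deriv ^^ m) f t * c) \<longlongrightarrow> (deriv ^^ m) f t0 * c) (nhds t0)"
    unfolding continuous_at tendsto_at_iff_tendsto_nhds[of "\<lambda>t. (deriv ^^ m) f t * c"] .
  moreover have "c * c > 0"
    using c by (auto simp: zero_less_mult_iff linorder_neq_iff)
  then have "(deriv ^^ m) f t0 * c > 0"
    by (simp only: c_def)
  ultimately have "eventually (\<lambda>t. (deriv ^^ m) f t * c > 0) (nhds t0)"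
    by (rule order_tendstoD(1))
  then obtain d where d: "d > 0" "\<And>t. \<bar>t - t0\<bar> < d \<Longrightarrow> (deriv ^^ m) f t * c > 0"
    unfolding eventually_nhds_metric dist_real_def by blast
  \<comment> \<open>Taylor's formula is applied on the closed interval of radius \<open>e\<close>,
    which halving \<open>r\<close> keeps inside the open domain of the derivatives.\<close>
  define e where "e = min d (r / 2)"
  have "f t * (c * (t - t0) ^ m) > 0" if t: "t \<noteq> t0" "\<bar>t - t0\<bar> < e" for t
  proof (cases "m = 0")
    case True
    then show ?thesis
      using d(2)[of t] t by (simp add: e_def)
  next
    case False
    have "\<exists>x. (if t < t0 then t < x \<and> x < t0 else t0 < x \<and> x < t) \<and>
        f t = (\<Sum>k<m. (deriv ^^ k) f t0 / fact k * (t - t0) ^ k) + (deriv ^^ m) f x / fact m * (t - t0) ^ m"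
    proof (rule Taylor[where a="t0 - e" and b="t0 + e"])
      show "\<forall>k x. k < m \<and> t0 - e \<le> x \<and> x \<le> t0 + e \<longrightarrow>
          ((deriv ^^ k) f has_real_derivative (deriv ^^ Suc k) f x) (at x)"
      proof (intro allI impI)
        fix k x assume "k < m \<and> t0 - e \<le> x \<and> x \<le> t0 + e"
        then have "\<bar>x - t0\<bar> < r"
          using r unfolding e_def by linarith
        then show "((deriv ^^ k) f has_real_derivative (deriv ^^ Suc k) f x) (at x)"
          by (rule D)
      qed
    qed (use False t in auto)
    moreover have "(\<Sum>k<m. (deriv ^^ k) f t0 / fact k * (t - t0) ^ k) = 0"
      using lower by (intro sum.neutral) simp
    ultimately obtain x where x: "if t < t0 then t < x \<and> x < t0 else t0 < x \<and> x < t"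
      "f t = (deriv ^^ m) f x / fact m * (t - t0) ^ m"
      by auto
    have "\<bar>x - t0\<bar> < d"
      using x(1) t unfolding e_def by (auto split: if_splits)
    then have "(deriv ^^ m) f x * c > 0"
      by (rule d(2))
    moreover have "((t - t0) ^ m)\<^sup>2 > 0"
      using t(1) by (subst zero_less_power2) simp
    then have "(t - t0) ^ m * (t - t0) ^ m > 0"
      unfolding power2_eq_square .
    ultimately have "((deriv ^^ m) f x * c) * ((t - t0) ^ m * (t - t0) ^ m) / fact m > 0"
      by (intro divide_pos_pos mult_pos_pos[of "(deriv ^^ m) f x * c"]) auto
    then show ?thesis
      unfolding x(2) by (simp add: mult_ac)
  qed
  then show ?thesis
    using d(1) r by (intro exI[of _ e]) (auto simp: e_def)
qed

text \<open>Unlike in \<open>Z_down_right\<close>, no zero at \<open>t0\<close> is demanded. Summed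
  over the branches this counts the eigenvalues negative just after \<open>t0\<close>, which is the
  combination of \<open>neg_index\<close> and \<open>Z_down_right\<close> in the theorem.\<close>

definition neg_right :: "(real \<Rightarrow> real) \<Rightarrow> real \<Rightarrow> bool" where
  "neg_right f t0 \<longleftrightarrow> eventually (\<lambda>t. f t < 0) (at_right t0)"

definition neg_left :: "(real \<Rightarrow> real) \<Rightarrow> real \<Rightarrow> bool" where
  "neg_left f t0 \<longleftrightarrow> eventually (\<lambda>t. f t < 0) (at_left t0)"

lemma eventually_neg_iff_of_sign:
  fixes f :: "real \<Rightarrow> real"
  assumes "eventually (\<lambda>t. f t * k > 0) F" "F \<noteq> bot"
  shows "eventually (\<lambda>t. f t < 0) F \<longleftrightarrow> k < 0"
proof
  assume "eventually (\<lambda>t. f t < 0) F"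
  with assms(1) have "eventually (\<lambda>t. f t * k > 0 \<and> f t < 0) F"
    by (rule eventually_conj)
  from eventually_happens'[OF assms(2) this] show "k < 0"
    by (auto simp: zero_less_mult_iff)
next
  assume "k < 0"
  show "eventually (\<lambda>t. f t < 0) F"
    using assms(1) by (rule eventually_mono) (use \<open>k < 0\<close> in \<open>auto simp: zero_less_mult_iff\<close>)
qed

text \<open>For even \<open>m\<close> the sign is the same on both sides and the two Krein
  contributions cancel; for odd \<open>m\<close> both differences equal the sign of the leading
  derivative. The case \<open>m = 0\<close> is a point where \<open>f\<close> is nonzero.\<close>

lemma neg_jump_eq_krein:
  assumes "real_analytic_at f t0" "\<not> eventually (\<lambda>t. f t = 0) (nhds t0)"
  shows "of_bool (neg_left f t0) - of_bool (neg_right f t0)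
    = krein_branch_plus f t0 - krein_branch_minus f t0"
proof -
  define m where "m = vanishing_order f t0"
  define c where "c = (deriv ^^ m) f t0"
  have c: "c \<noteq> 0"
    unfolding c_def m_def by (rule vanishing_order_properties[OF assms])
  obtain e where e: "e > 0" "\<And>t. t \<noteq> t0 \<Longrightarrow> \<bar>t - t0\<bar> < e \<Longrightarrow> f t * (c * (t - t0) ^ m) > 0"
    using sign_near_zero[OF assms] unfolding c_def m_def by blast
  have "eventually (\<lambda>t. f t * c > 0) (at_right t0)"
    unfolding eventually_at
  proof (intro exI[of _ e] conjI ballI impI)
    fix t assume "t \<in> {t0<..}" "t \<noteq> t0 \<and> dist t t0 < e"
    then have "f t * (c * (t - t0) ^ m) > 0" "(t - t0) ^ m > 0"
      using e(2)[of t] by (auto simp: dist_norm)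
    then show "f t * c > 0"
      unfolding mult.assoc[symmetric] by (rule zero_less_mult_pos2)
  qed (rule e)
  then have right: "neg_right f t0 \<longleftrightarrow> c < 0"
    unfolding neg_right_def by (rule eventually_neg_iff_of_sign) simp
  have "eventually (\<lambda>t. f t * (c * (- 1) ^ m) > 0) (at_left t0)"
    unfolding eventually_at
  proof (intro exI[of _ e] conjI ballI impI)
    fix t assume t: "t \<in> {..<t0}" "t \<noteq> t0 \<and> dist t t0 < e"
    have "(t - t0) ^ m = (- 1) ^ m * (t0 - t) ^ m"
      by (simp flip: power_mult_distrib)
    then have "f t * (c * (- 1) ^ m) * (t0 - t) ^ m > 0"
      using e(2)[of t] t by (simp add: dist_norm mult_ac)
    moreover have "(t0 - t) ^ m > 0"
      using t by simp
    ultimately show "f t * (c * (- 1) ^ m) > 0"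
      using zero_less_mult_pos2 by blast
  qed (rule e)
  then have left: "neg_left f t0 \<longleftrightarrow> c * (- 1) ^ m < 0"
    unfolding neg_left_def by (rule eventually_neg_iff_of_sign) simp
  show ?thesis
  proof (cases "even m")
    case True
    then show ?thesis
      using left right
      by (simp add: krein_branch_plus_def krein_branch_minus_def Let_def flip: m_def)
  next
    case False
    have "branch_sign f t0 = sgn c"
      by (simp add: branch_sign_def c_def m_def)
    then show ?thesis
      using left right False c
      by (simp add: krein_branch_plus_def krein_branch_minus_def Let_def sgn_if field_simps flip: m_def)
  qed
qed

lemma real_analytic_at_imp_isCont:
  assumes "real_analytic_at f t0"
  shows "isCont f t0"
  using assms
proof (rule real_analytic_at_higher_deriv)
  fix r g
  assume "r > 0"
    and D: "\<And>k t. \<bar>t\<bar> < r \<Longrightarrow> ((deriv ^^ k) f has_real_derivative (deriv ^^ Suc k) f (t0 + t)) (at (t0 + t))"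
  then show ?thesis
    using DERIV_isCont[OF D[of 0 0]] by simp
qed

lemma sign_constant_between_zeros:
  fixes f :: "real \<Rightarrow> real"
  assumes cont: "\<And>t. isCont f t" and nz: "\<And>t. a < t \<Longrightarrow> t < b \<Longrightarrow> f t \<noteq> 0"
    and x: "a < x" "x < b" "f x < 0" and y: "a < y" "y < b"
  shows "f y < 0"
proof (rule ccontr)
  assume "\<not> f y < 0"
  then have fy: "f y \<ge> 0"
    by simp
  have co: "continuous_on S f" for S
    using cont by (simp add: continuous_at_imp_continuous_on)
  have "\<exists>z. a < z \<and> z < b \<and> f z = 0"
  proof (cases "x \<le> y")
    case True
    then obtain z where "x \<le> z" "z \<le> y" "f z = 0"
      using IVT'[of f x 0 y] fy x co by auto
    then show ?thesis
      using x y by (intro exI[of _ z]) auto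
  next
    case False
    then obtain z where "y \<le> z" "z \<le> x" "f z = 0"
      using IVT2'[of f x 0 y] fy x co by auto
    then show ?thesis
      using x y by (intro exI[of _ z]) auto
  qed
  then show False
    using nz by blast
qed

lemma neg_right_eq_neg_left_between_zeros:
  fixes f :: "real \<Rightarrow> real"
  assumes cont: "\<And>t. isCont f t" and nz: "\<And>t. a < t \<Longrightarrow> t < b \<Longrightarrow> f t \<noteq> 0" and ab: "a < b"
  shows "neg_right f a \<longleftrightarrow> neg_left f b"
proof -
  have right: "eventually (\<lambda>t. t \<in> {a<..<b}) (at_right a)"
    using ab by (rule eventually_at_right_real)
  have left: "eventually (\<lambda>t. t \<in> {a<..<b}) (at_left b)"
    using ab by (rule eventually_at_left_real)
  note const = sign_constant_between_zeros[OF cont nz]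
  show ?thesis
  proof
    assume "neg_right f a"
    from eventually_happens'[OF _ eventually_conj[OF this[unfolded neg_right_def] right]]
    obtain x where x: "a < x" "x < b" "f x < 0"
      by auto
    show "neg_left f b"
      unfolding neg_left_def using left by (rule eventually_mono) (use const x in auto)
  next
    assume "neg_left f b"
    from eventually_happens'[OF _ eventually_conj[OF this[unfolded neg_left_def] left]]
    obtain x where x: "a < x" "x < b" "f x < 0"
      by auto
    show "neg_right f a"
      unfolding neg_right_def using right by (rule eventually_mono) (use const x in auto)
  qed
qed

text \<open>The interval is cut at any interior zero \<open>c\<close>, which belongs to neither
  half, so both have fewer zeros. The boundary terms at \<open>c\<close> cancel against the jump
  there. Zeros at \<open>a\<close> or \<open>b\<close> contribute nothing to the sum, as the
  indicators look inward.\<close>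

lemma neg_right_minus_neg_left_eq_sum:
  fixes f :: "real \<Rightarrow> real"
  assumes an: "\<And>t. real_analytic_at f t" and nz: "\<And>t. \<not> eventually (\<lambda>t. f t = 0) (nhds t)"
    and fin: "finite {t. a < t \<and> t < b \<and> f t = 0}" and ab: "a < b"
  shows "of_bool (neg_right f a) - of_bool (neg_left f b)
    = (\<Sum>t\<in>{t. a < t \<and> t < b \<and> f t = 0}. krein_branch_plus f t - krein_branch_minus f t)"
  using fin ab
proof (induction "card {t. a < t \<and> t < b \<and> f t = 0}" arbitrary: a b rule: less_induct)
  case less
  define Z where "Z a b = {t. a < t \<and> t < b \<and> f t = 0}" for a b
  define \<kappa> where "\<kappa> t = krein_branch_plus f t - krein_branch_minus f t" for t
  have IH: "of_bool (neg_right f a') - of_bool (neg_left f b') = sum \<kappa> (Z a' b')"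
    if "card (Z a' b') < card (Z a b)" "finite (Z a' b')" "a' < b'" for a' b'
    using less.hyps that unfolding Z_def \<kappa>_def by blast
  have fin: "finite (Z a b)"
    using less.prems(1) unfolding Z_def .
  have "of_bool (neg_right f a) - of_bool (neg_left f b) = sum \<kappa> (Z a b)"
  proof (cases "Z a b = {}")
    case True
    then have "neg_right f a \<longleftrightarrow> neg_left f b"
      using real_analytic_at_imp_isCont[OF an] less.prems(2)
      by (intro neg_right_eq_neg_left_between_zeros) (auto simp: Z_def)
    then show ?thesis
      using True by simp
  next
    case False
    then obtain c where c: "c \<in> Z a b"
      by blast
    have split: "Z a b = insert c (Z a c \<union> Z c b)"
      using c by (auto simp: Z_def)
    have "Z a c \<subseteq> Z a b - {c}" "Z c b \<subseteq> Z a b - {c}"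
      using c by (auto simp: Z_def)
    then have "Z a c \<subset> Z a b" "Z c b \<subset> Z a b"
      using c by blast+
    then have card: "card (Z a c) < card (Z a b)" "card (Z c b) < card (Z a b)"
      and fin': "finite (Z a c)" "finite (Z c b)"
      using fin by (auto intro: psubset_card_mono finite_subset)
    have disj: "Z a c \<inter> Z c b = {}" "c \<notin> Z a c \<union> Z c b"
      by (auto simp: Z_def)
    have "sum \<kappa> (Z a b) = \<kappa> c + (sum \<kappa> (Z a c) + sum \<kappa> (Z c b))"
      unfolding split using fin' disj by (simp add: sum.union_disjoint)
    moreover have "sum \<kappa> (Z a c) = of_bool (neg_right f a) - of_bool (neg_left f c)"
      "sum \<kappa> (Z c b) = of_bool (neg_right f c) - of_bool (neg_left f b)"
      using IH[OF card(1) fin'(1)] IH[OF card(2) fin'(2)] c by (auto simp: Z_def)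
    moreover have "\<kappa> c = of_bool (neg_left f c) - of_bool (neg_right f c)"
      unfolding \<kappa>_def using neg_jump_eq_krein[OF an nz] by simp
    ultimately show ?thesis
      by simp
  qed
  then show ?case
    unfolding Z_def \<kappa>_def .
qed

text \<open>By continuity a nonzero value decides the sign on both sides. This splits a one-sided
  count into the part seen by \<open>neg_index\<close> and the part seen by
  \<open>Z_down_right\<close> or \<open>Z_down_left\<close>.\<close>

lemma neg_side_iff:
  assumes "isCont f t0"
  shows "neg_right f t0 \<longleftrightarrow> f t0 < 0 \<or> f t0 = 0 \<and> neg_right f t0"
    and "neg_left f t0 \<longleftrightarrow> f t0 < 0 \<or> f t0 = 0 \<and> neg_left f t0"
proof -
  have "eventually (\<lambda>t. f t * f t0 > 0) (at t0 within S)" if "f t0 \<noteq> 0" for S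
  proof -
    have "((\<lambda>t. f t * f t0) \<longlongrightarrow> f t0 * f t0) (at t0 within S)"
      using assms by (intro tendsto_intros) (simp add: isCont_def tendsto_within_subset[of _ _ _ UNIV])
    then show ?thesis
      by (rule order_tendstoD(1)) (use that in \<open>auto simp: zero_less_mult_iff linorder_neq_iff\<close>)
  qed
  from eventually_neg_iff_of_sign[OF this] have
    "neg_right f t0 \<longleftrightarrow> f t0 < 0" "neg_left f t0 \<longleftrightarrow> f t0 < 0" if "f t0 \<noteq> 0"
    using that unfolding neg_right_def neg_left_def by simp_all
  then show "neg_right f t0 \<longleftrightarrow> f t0 < 0 \<or> f t0 = 0 \<and> neg_right f t0"
    "neg_left f t0 \<longleftrightarrow> f t0 < 0 \<or> f t0 = 0 \<and> neg_left f t0"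
    by (cases "f t0 = 0"; simp)+
qed

section \<open>Characteristic values and negative index in terms of eigenvalue
  multiplicities\<close>

lemma char_values_iff_eig_mult:
  assumes "L t \<in> carrier_mat n n"
  shows "t \<in> char_values n L \<longleftrightarrow> eig_mult (L t) 0 > 0"
proof -
  have "t \<in> char_values n L \<longleftrightarrow> (\<exists>v. v \<in> carrier_vec n \<and> v \<noteq> 0\<^sub>v n \<and> L t *\<^sub>v v = 0\<^sub>v n)"
    using assms unfolding char_values_def mat_kernel_def by auto
  also have "\<dots> \<longleftrightarrow> eigenvalue (L t) 0"
  proof -
    have "0 \<cdot>\<^sub>v v = 0\<^sub>v n" if "v \<in> carrier_vec n" for v :: "complex vec"
      using that by (intro eq_vecI) auto
    then show ?thesis
      using assms unfolding eigenvalue_def eigenvector_def by auto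
  qed
  also have "\<dots> \<longleftrightarrow> eig_mult (L t) 0 > 0"
  proof -
    have "char_poly (L t) \<noteq> 0"
      using degree_monic_char_poly[OF assms] by auto
    then show ?thesis
      unfolding eigenvalue_root_char_poly[OF assms] eig_mult_def by (simp add: order_root)
  qed
  finally show ?thesis .
qed

lemma neg_index_eq_card:
  assumes A: "A \<in> carrier_mat n n"
    and mult: "\<And>z. eig_mult A z = card {i. i < n \<and> complex_of_real (d i) = z}"
  shows "neg_index A = card {i. i < n \<and> d i < 0}"
proof -
  define S where "S = {i. i < n \<and> d i < 0}"
  have "finite S"
    by (simp add: S_def)
  have nz: "char_poly A \<noteq> 0"
    using degree_monic_char_poly[OF A] by auto
  have "eigenvalue A (of_real x) \<longleftrightarrow> (\<exists>i<n. d i = x)" for x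
  proof -
    have "eigenvalue A (of_real x) \<longleftrightarrow> eig_mult A (of_real x) \<noteq> 0"
      unfolding eigenvalue_root_char_poly[OF A] eig_mult_def using nz by (simp add: order_root)
    also have "\<dots> \<longleftrightarrow> (\<exists>i<n. d i = x)"
      unfolding mult by auto
    finally show ?thesis .
  qed
  then have X: "{x. x < 0 \<and> eigenvalue A (of_real x)} = d ` S"
    by (auto simp: S_def)
  have "card S = (\<Sum>x\<in>d ` S. card {i \<in> S. d i = x})"
    using sum.image_gen[OF \<open>finite S\<close>, of "\<lambda>_. 1::nat" d] by simp
  also have "\<dots> = (\<Sum>x\<in>d ` S. eig_mult A (of_real x))"
  proof (rule sum.cong[OF refl])
    fix x assume "x \<in> d ` S"
    then have "{i \<in> S. d i = x} = {i. i < n \<and> complex_of_real (d i) = of_real x}"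
      by (auto simp: S_def)
    then show "card {i \<in> S. d i = x} = eig_mult A (of_real x)"
      unfolding mult by simp
  qed
  finally show ?thesis
    unfolding neg_index_def X by (simp add: S_def)
qed

theorem theorem4:
  fixes n :: nat
    and L :: "real \<Rightarrow> complex mat"
    and l1 l2 :: real
  assumes "analytic_hermitian_pencil n L"
    and "\<forall>t\<in>char_values n L. t isolated_in char_values n L"
    and "l1 < l2"
  shows "real (neg_index (L l1)) - real (neg_index (L l2))
           + real (Z_down_right n L l1) - real (Z_down_left n L l2)
         = (\<Sum>t\<in>{t \<in> char_values n L. l1 < t \<and> t < l2}. krein_signature n L t)"
proof -
  define \<mu> where "\<mu> = eigenvalue_branches n L"
  define \<kappa> where "\<kappa> i t = krein_branch_plus (\<mu> i) t - krein_branch_minus (\<mu> i) t" for i t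
  have L: "L t \<in> carrier_mat n n" for t
    using assms(1) unfolding analytic_hermitian_pencil_def by blast
  have "is_eigenvalue_branches n L \<mu>"
    unfolding \<mu>_def using assms(1) by (rule eigenvalue_branches)
  then have an: "\<And>i t. i < n \<Longrightarrow> real_analytic_at (\<mu> i) t"
    and mult: "\<And>t z. eig_mult (L t) z = card {i. i < n \<and> complex_of_real (\<mu> i t) = z}"
    unfolding is_eigenvalue_branches_def by (auto intro: real_analytic_at_if_real_analytic)
  note cont = real_analytic_at_imp_isCont[OF an]
  have cv: "t \<in> char_values n L \<longleftrightarrow> (\<exists>i<n. \<mu> i t = 0)" for t
    unfolding char_values_iff_eig_mult[OF L] mult by (auto simp: card_gt_0_iff)
  \<comment> \<open>Isolation excludes limit points that are characteristic values themselves.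
    Others do not exist because the characteristic values form a closed set, a finite union of zero
    sets of continuous branches.\<close>
  have not_lim: "\<not> t islimpt char_values n L" for t
  proof
    assume lim: "t islimpt char_values n L"
    have "closed {t. \<mu> i t = 0}" if "i < n" for i
      using cont[OF that] by (intro closed_Collect_eq continuous_at_imp_continuous_on) auto
    then have "closed (\<Union>i<n. {t. \<mu> i t = 0})"
      by (intro closed_UN) auto
    moreover have "char_values n L = (\<Union>i<n. {t. \<mu> i t = 0})"
      using cv by auto
    ultimately have "t \<in> char_values n L"
      using lim closed_limpt by metis
    then show False
      using assms(2) lim isolated_in_islimpt_iff by blast
  qed
  define C where "C = {t \<in> char_values n L. l1 < t \<and> t < l2}"
  have "finite C"
  proof (rule ccontr)
    assume "infinite C"
    moreover have "C \<subseteq> {l1..l2}"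
      by (auto simp: C_def)
    ultimately obtain t where "t islimpt C"
      using Heine_Borel_imp_Bolzano_Weierstrass[OF compact_Icc] by blast
    then show False
      using islimpt_subset[of t C "char_values n L"] not_lim by (auto simp: C_def)
  qed
  have nz: "\<not> eventually (\<lambda>t. \<mu> i t = 0) (nhds t)" if i: "i < n" for i t
  proof
    assume "eventually (\<lambda>t. \<mu> i t = 0) (nhds t)"
    then have "eventually (\<lambda>t. t \<in> char_values n L) (at t)"
      unfolding eventually_nhds_conv_at using cv i by (auto elim: eventually_mono)
    then have "t islimpt char_values n L"
      unfolding islimpt_conv_frequently_at by (rule eventually_frequently[rotated]) simp
    then show False
      using not_lim by simp
  qed
  \<comment> \<open>The four terms of the theorem are regrouped into the number of branches negative
    just after \<open>l1\<close> and the number negative just before \<open>l2\<close>.\<close>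
  have right: "real (neg_index (L l1)) + real (Z_down_right n L l1) = (\<Sum>i<n. of_bool (neg_right (\<mu> i) l1))"
  proof -
    have "neg_index (L l1) + Z_down_right n L l1 =
        card {i. i < n \<and> \<mu> i l1 < 0} + card {i. i < n \<and> \<mu> i l1 = 0 \<and> neg_right (\<mu> i) l1}"
      unfolding neg_index_eq_card[OF L mult] Z_down_right_def vanishing_branches_def neg_right_def \<mu>_def
      by simp
    also have "\<dots> = card ({i. i < n \<and> \<mu> i l1 < 0} \<union> {i. i < n \<and> \<mu> i l1 = 0 \<and> neg_right (\<mu> i) l1})"
      by (rule card_Un_disjoint[symmetric]) auto
    also have "{i. i < n \<and> \<mu> i l1 < 0} \<union> {i. i < n \<and> \<mu> i l1 = 0 \<and> neg_right (\<mu> i) l1} =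
        {..<n} \<inter> {i. neg_right (\<mu> i) l1}"
      using neg_side_iff(1)[OF cont] by blast
    finally have "real (neg_index (L l1) + Z_down_right n L l1) = real (card ({..<n} \<inter> {i. neg_right (\<mu> i) l1}))"
      by simp
    then show ?thesis
      by (simp add: sum_of_bool_eq)
  qed
  have left: "real (neg_index (L l2)) + real (Z_down_left n L l2) = (\<Sum>i<n. of_bool (neg_left (\<mu> i) l2))"
  proof -
    have "neg_index (L l2) + Z_down_left n L l2 =
        card {i. i < n \<and> \<mu> i l2 < 0} + card {i. i < n \<and> \<mu> i l2 = 0 \<and> neg_left (\<mu> i) l2}"
      unfolding neg_index_eq_card[OF L mult] Z_down_left_def vanishing_branches_def neg_left_def \<mu>_def
      by simp
    also have "\<dots> = card ({i. i < n \<and> \<mu> i l2 < 0} \<union> {i. i < n \<and> \<mu> i l2 = 0 \<and> neg_left (\<mu> i) l2})"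
      by (rule card_Un_disjoint[symmetric]) auto
    also have "{i. i < n \<and> \<mu> i l2 < 0} \<union> {i. i < n \<and> \<mu> i l2 = 0 \<and> neg_left (\<mu> i) l2} =
        {..<n} \<inter> {i. neg_left (\<mu> i) l2}"
      using neg_side_iff(2)[OF cont] by blast
    finally have "real (neg_index (L l2) + Z_down_left n L l2) = real (card ({..<n} \<inter> {i. neg_left (\<mu> i) l2}))"
      by simp
    then show ?thesis
      by (simp add: sum_of_bool_eq)
  qed
  have zeros: "{t. l1 < t \<and> t < l2 \<and> \<mu> i t = 0} = {t \<in> C. \<mu> i t = 0}" if "i < n" for i
    using that cv by (auto simp: C_def)
  have "real (neg_index (L l1)) - real (neg_index (L l2))
      + real (Z_down_right n L l1) - real (Z_down_left n L l2)
      = (\<Sum>i<n. of_bool (neg_right (\<mu> i) l1) - of_bool (neg_left (\<mu> i) l2))"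
    using left right by (simp add: sum_subtractf)
  also have "\<dots> = (\<Sum>i<n. \<Sum>t\<in>{t \<in> C. \<mu> i t = 0}. \<kappa> i t)"
  proof (rule sum.cong[OF refl])
    fix i assume "i \<in> {..<n}"
    then have i: "i < n"
      by simp
    have "finite {t. l1 < t \<and> t < l2 \<and> \<mu> i t = 0}"
      unfolding zeros[OF i] using \<open>finite C\<close> by simp
    then show "of_bool (neg_right (\<mu> i) l1) - of_bool (neg_left (\<mu> i) l2) = (\<Sum>t\<in>{t \<in> C. \<mu> i t = 0}. \<kappa> i t)"
      unfolding zeros[OF i, symmetric] \<kappa>_def
      by (rule neg_right_minus_neg_left_eq_sum[OF an[OF i] nz[OF i] _ assms(3)])
  qed
  \<comment> \<open>Grouping the jumps by point instead of by branch turns the inner sum into the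
    Krein signature.\<close>
  also have "\<dots> = (\<Sum>t\<in>C. \<Sum>i\<in>{i \<in> {..<n}. \<mu> i t = 0}. \<kappa> i t)"
    using \<open>finite C\<close> by (intro sum.swap_restrict) auto
  also have "\<dots> = (\<Sum>t\<in>C. krein_signature n L t)"
    unfolding krein_signature_def krein_plus_def krein_minus_def vanishing_branches_def \<kappa>_def \<mu>_def
    by (simp add: sum_subtractf)
  finally show ?thesis
    unfolding C_def .
qed

end
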